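(* Let $k \ge 0$ be an integer and let $H$ be a $k$-strongly tree-decomposable graph. Then $H$ has Sidorenko's property, i.e. for every finite simple graph $G$ with non-empty vertex set, $$|\mathrm{Hom}(H,G)| \;\ge\; |V(G)|^{|V(H)|}\left(\frac{2|E(G)|}{|V(G)|^{2}}\right)^{|E(H)|}.$$
   Context: All graphs are finite and simple. $\mathrm{Hom}(H,G)$ is the set of graph homomorphisms from $H$ to $G$. For $X\subseteq V(H)$, $H[X]$ is the induced subgraph. A forest is an acyclic graph (possibly without edges, possibly empty). **Tree decompositions.** A tree decomposition of a graph $H$ is a pair $(\mathcal F,\mathcal T)$, where $\mathcal F$ is a family of subsets of $V(H)$ and $\mathcal T$ is a tree with vertex set $\mathcal F$, such that (a) $\bigcup_{X\in\mathcal F}X=V(H)$; (b) every edge of $H$ is contained in some $X\in\mathcal F$; (c) for $X,Y,Z\in\mathcal F$, $X\cap Y\subseteq Z$ whenever $Z$ lies on the path from $X$ to $Y$ in $\mathcal T$. For $u\in V(H)$ write $\mathcal F(u)=\{X\in\mathcal F: u\in X\}$; for $U=\emptyset$ read $\bigcap_{u\in U}\mathcal F(u)$ as $\mathcal F$. A retraction of $(\mathcal F,\mathcal T)$ is a pair $(\mathcal F',\mathcal T')$ obtained by successively deleting leaves of $\mathcal T$ to obtain a tree $\mathcal T'$ and putting $\mathcal F'=V(\mathcal T')$; it is a tree decomposition of $H[\bigcup_{X\in\mathcal F'}X]$. The following notions (strong tree decompositions, minimum sub-decompositions, isomorphisms) are defined simultaneously by recursion on $k$. **Strong tree decompositions.**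 A $0$-strong tree decomposition of a tree $T$ is a pair $(\mathcal F,\mathcal T)$, where $\mathcal F=E(T)$ (edges viewed as two-element vertex sets) and $\mathcal T$ is a spanning tree of the line graph of $T$. (If $T$ has a single vertex $v$, take $\mathcal F=\{\{v\}\}$ and $\mathcal T$ the one-vertex tree.) For $k\ge1$, a $k$-strong tree decomposition $(\mathcal F,\mathcal T,\mathcal S)$ of a graph $H$ is a tree decomposition $(\mathcal F,\mathcal T)$ of $H$ together with a family $\mathcal S=(\mathcal F_X,\mathcal T_X,\mathcal S_X)_{X\in\mathcal F}$ of $(k-1)$-strong tree decompositions such that: 1. for each $X\in\mathcal F$, $(\mathcal F_X,\mathcal T_X,\mathcal S_X)$ is a $(k-1)$-strong tree decomposition of $H[X]$ (the last component is absent when $k-1=0$); 2. for each $XY\in E(\mathcal T)$, $H[X\cap Y]$ is a forest; 3. for each $XY\in E(\mathcal T)$, there is an isomorphism fixing every vertex of $X\cap Y$ between the minimum sub-decompositions containing $X\cap Y$ of $(\mathcal F_X,\mathcal T_X,\mathcal S_X)$ and of $(\mathcal F_Y,\mathcal T_Y,\mathcal S_Y)$. In all cases $H$ (respectively $T$) is called the underlying graph of the decomposition. A graph is $k$-strongly tree-decomposable if it is the underlying graph of some $k$-strong tree decomposition; in particular, it is $0$-strongly tree-decomposable if and only if it is a tree. **Minimum sub-decompositions.** Let $(\mathcal F,\mathcal T,\mathcal S)$ be a $k$-strong tree decomposition of $H$ and $U\subseteq V(H)$. - If $\bigcap_{u\in U}\mathcal F(u)=\emptyset$, there is a minimum (with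 respect to inclusion) subfamily $\mathcal F'\subseteq\mathcal F$ such that $U\subseteq\bigcup_{F\in\mathcal F'}F$ and $\mathcal F'$ induces a subtree $\mathcal T'$ of $\mathcal T$. The minimum sub-decomposition containing $U$ is $(\mathcal F',\mathcal T',\mathcal S')$, where $(\mathcal F',\mathcal T')$ is the corresponding retraction of $(\mathcal F,\mathcal T)$ and $\mathcal S'$ is the restriction of $\mathcal S$ to $\mathcal F'$ (no $\mathcal S'$ if $k=0$). It is a $k$-strong tree decomposition of $H[\bigcup_{F\in\mathcal F'}F]$. - If $\bigcap_{u\in U}\mathcal F(u)\neq\emptyset$ and $k\ge1$, the minimum sub-decomposition containing $U$ is the minimum sub-decomposition containing $U$ of the $(k-1)$-strong tree decomposition $(\mathcal F_X,\mathcal T_X,\mathcal S_X)$ for some $X\in\bigcap_{u\in U}\mathcal F(u)$; it need not be unique, but is regarded as unique up to isomorphism. - If $\bigcap_{u\in U}\mathcal F(u)\neq\emptyset$ and $k=0$, it is the retraction consisting of a single element $X\in\bigcap_{u\in U}\mathcal F(u)$ (with the one-vertex tree), again unique up to isomorphism. **Isomorphisms.** An isomorphism between two $0$-strong tree decompositions is a graph isomorphism between their underlying trees. For $k\ge1$, an isomorphism between $k$-strong tree decompositions $(\mathcal F_1,\mathcal T_1,\mathcal S_1)$ of $H_1$ and $(\mathcal F_2,\mathcal T_2,\mathcal S_2)$ of $H_2$ is a graph isomorphism $\phi:H_1\to H_2$ that induces an isomorphism between each corresponding pair of $(k-1)$-strong tree decompositions in $\mathcal S_1$ and $\mathcal S_2$;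 that is, $X\mapsto\phi(X)$ is a bijection $\mathcal F_1\to\mathcal F_2$ and, for each $X\in\mathcal F_1$, $\phi|_X$ is an isomorphism between the $(k-1)$-strong tree decompositions attached to $X$ and to $\phi(X)$. Isomorphism is only defined between decompositions of the same level $k$. *)

theory Defs
  imports Complex_Main "HOL-Library.FuncSet"
begin

section \<open>Finite simple graphs\<close>

datatype 'a ugraph = Graph (verts: "'a set") (edges: "'a set set")

definition simple_graph :: "'a ugraph \<Rightarrow> bool" where
  "simple_graph G \<longleftrightarrow> finite (verts G) \<and> (\<forall>e\<in>edges G. e \<subseteq> verts G \<and> card e = 2)"

definition induced :: "'a ugraph \<Rightarrow> 'a set \<Rightarrow> 'a ugraph" where
  "induced G X = Graph X {e \<in> edges G. e \<subseteq> X}"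

definition graph_path :: "'a ugraph \<Rightarrow> 'a list \<Rightarrow> bool" where
  "graph_path G p \<longleftrightarrow> p \<noteq> [] \<and> distinct p \<and> set p \<subseteq> verts G
     \<and> successively (\<lambda>u v. {u, v} \<in> edges G) p"

definition path_between :: "'a ugraph \<Rightarrow> 'a \<Rightarrow> 'a list \<Rightarrow> 'a \<Rightarrow> bool" where
  "path_between G u p v \<longleftrightarrow> graph_path G p \<and> hd p = u \<and> last p = v"

definition graph_cycle :: "'a ugraph \<Rightarrow> 'a list \<Rightarrow> bool" where
  "graph_cycle G c \<longleftrightarrow> 3 \<le> length c \<and> graph_path G c \<and> {last c, hd c} \<in> edges G"

definition connected_graph :: "'a ugraph \<Rightarrow> bool" where
  "connected_graph G \<longleftrightarrow> verts G \<noteq> {} \<and> (\<forall>u\<in>verts G. \<forall>v\<in>verts G. \<exists>p. path_between G u p v)"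

definition forest :: "'a ugraph \<Rightarrow> bool" where
  "forest G \<longleftrightarrow> simple_graph G \<and> (\<nexists>c. graph_cycle G c)"

definition tree :: "'a ugraph \<Rightarrow> bool" where
  "tree G \<longleftrightarrow> forest G \<and> connected_graph G"

definition spanning_tree :: "'a ugraph \<Rightarrow> 'a ugraph \<Rightarrow> bool" where
  "spanning_tree T G \<longleftrightarrow> tree T \<and> verts T = verts G \<and> edges T \<subseteq> edges G"

definition line_graph :: "'a ugraph \<Rightarrow> 'a set ugraph" where
  "line_graph G = Graph (edges G)
     {{e, f} | e f. e \<in> edges G \<and> f \<in> edges G \<and> e \<noteq> f \<and> e \<inter> f \<noteq> {}}"

definition graph_iso :: "('a \<Rightarrow> 'b) \<Rightarrow> 'a ugraph \<Rightarrow> 'b ugraph \<Rightarrow> bool" where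
  "graph_iso \<phi> G H \<longleftrightarrow> bij_betw \<phi> (verts G) (verts H) \<and>
     (\<forall>u\<in>verts G. \<forall>v\<in>verts G. {u, v} \<in> edges G \<longleftrightarrow> {\<phi> u, \<phi> v} \<in> edges H)"

text \<open>Homomorphisms are extensional functions on the vertex set, so that each of them
  is counted exactly once.\<close>

definition Hom :: "'a ugraph \<Rightarrow> 'b ugraph \<Rightarrow> ('a \<Rightarrow> 'b) set" where
  "Hom H G = {f \<in> verts H \<rightarrow>\<^sub>E verts G.
     \<forall>u\<in>verts H. \<forall>v\<in>verts H. {u, v} \<in> edges H \<longrightarrow> {f u, f v} \<in> edges G}"

section \<open>Tree decompositions\<close>

definition tree_decomposition :: "'a ugraph \<Rightarrow> 'a set set \<Rightarrow> 'a set ugraph \<Rightarrow> bool" where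
  "tree_decomposition H F T \<longleftrightarrow> tree T \<and> verts T = F
     \<and> \<Union>F = verts H
     \<and> (\<forall>e\<in>edges H. \<exists>X\<in>F. e \<subseteq> X)
     \<and> (\<forall>X\<in>F. \<forall>Y\<in>F. \<forall>Z\<in>F. (\<exists>p. path_between T X p Y \<and> Z \<in> set p) \<longrightarrow> X \<inter> Y \<subseteq> Z)"

section \<open>Strong tree decompositions\<close>

text \<open>Raw nested decomposition data: \<open>Base F T\<close> is the pair at level 0, and \<open>Step F T S\<close>
  the triple at a positive level, where only the values of \<open>S\<close> on \<open>F\<close> matter. The underlying
  graph is not stored. Minimum sub-decompositions and isomorphisms are defined on raw data,
  which separates them from the recursion on the level in \<open>strong_tree_decomposition\<close>.\<close>

datatype 'a sdecomp =
    Base "'a set set" "'a set ugraph"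
  | Step "'a set set" "'a set ugraph" "'a set \<Rightarrow> 'a sdecomp"

primrec bags :: "'a sdecomp \<Rightarrow> 'a set set" where
  "bags (Base F T) = F"
| "bags (Step F T S) = F"

text \<open>The intersection of the families \<open>{X \<in> F. u \<in> X}\<close> over \<open>u \<in> U\<close>, which is all of \<open>F\<close>
  when \<open>U\<close> is empty.\<close>

definition bags_containing :: "'a set set \<Rightarrow> 'a set \<Rightarrow> 'a set set" where
  "bags_containing F U = {X \<in> F. \<forall>u\<in>U. u \<in> X}"

definition covering_subtree :: "'a set set \<Rightarrow> 'a set ugraph \<Rightarrow> 'a set \<Rightarrow> 'a set set \<Rightarrow> bool" where
  "covering_subtree F T U F' \<longleftrightarrow> F' \<subseteq> F \<and> U \<subseteq> \<Union>F' \<and> tree (induced T F')"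

definition minimum_covering_subtree ::
    "'a set set \<Rightarrow> 'a set ugraph \<Rightarrow> 'a set \<Rightarrow> 'a set set \<Rightarrow> bool" where
  "minimum_covering_subtree F T U F' \<longleftrightarrow> covering_subtree F T U F'
     \<and> (\<forall>F''. covering_subtree F T U F'' \<longrightarrow> F' \<subseteq> F'')"

text \<open>\<open>min_subdecomp D U D'\<close>: \<open>D'\<close> is a minimum sub-decomposition of \<open>D\<close> containing \<open>U\<close>.
  This is a relation because of the free choice of a bag \<open>X\<close> when some bag contains \<open>U\<close>.\<close>

inductive min_subdecomp :: "'a sdecomp \<Rightarrow> 'a set \<Rightarrow> 'a sdecomp \<Rightarrow> bool" where
  Base_span: "\<lbrakk>bags_containing F U = {}; minimum_covering_subtree F T U F'\<rbrakk>
    \<Longrightarrow> min_subdecomp (Base F T) U (Base F' (induced T F'))"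
| Base_bag: "X \<in> bags_containing F U
    \<Longrightarrow> min_subdecomp (Base F T) U (Base {X} (Graph {X} {}))"
| Step_span: "\<lbrakk>bags_containing F U = {}; minimum_covering_subtree F T U F'\<rbrakk>
    \<Longrightarrow> min_subdecomp (Step F T S) U (Step F' (induced T F') (restrict S F'))"
| Step_bag: "\<lbrakk>X \<in> bags_containing F U; min_subdecomp (S X) U D\<rbrakk>
    \<Longrightarrow> min_subdecomp (Step F T S) U D"

text \<open>\<open>sdecomp_iso \<phi> H1 D1 H2 D2\<close>: \<open>\<phi>\<close> is an isomorphism from \<open>D1\<close> to \<open>D2\<close>, whose underlying
  graphs are \<open>H1\<close> and \<open>H2\<close>. There is no requirement on the trees of the decompositions.\<close>

inductive sdecomp_iso ::
    "('a \<Rightarrow> 'b) \<Rightarrow> 'a ugraph \<Rightarrow> 'a sdecomp \<Rightarrow> 'b ugraph \<Rightarrow> 'b sdecomp \<Rightarrow> bool" for \<phi> where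
  Base: "graph_iso \<phi> H1 H2 \<Longrightarrow> sdecomp_iso \<phi> H1 (Base F1 T1) H2 (Base F2 T2)"
| Step: "\<lbrakk>graph_iso \<phi> H1 H2; bij_betw (\<lambda>X. \<phi> ` X) F1 F2;
     \<forall>X\<in>F1. sdecomp_iso \<phi> (induced H1 X) (S1 X) (induced H2 (\<phi> ` X)) (S2 (\<phi> ` X))\<rbrakk>
    \<Longrightarrow> sdecomp_iso \<phi> H1 (Step F1 T1 S1) H2 (Step F2 T2 S2)"

primrec strong_tree_decomposition :: "nat \<Rightarrow> 'a ugraph \<Rightarrow> 'a sdecomp \<Rightarrow> bool" where
  "strong_tree_decomposition 0 H D \<longleftrightarrow> (\<exists>F T. D = Base F T \<and> tree H \<and>
     (if card (verts H) = 1 then F = {verts H} \<and> T = Graph F {}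
      else F = edges H \<and> spanning_tree T (line_graph H)))"
| "strong_tree_decomposition (Suc k) H D \<longleftrightarrow> (\<exists>F T S. D = Step F T S
     \<and> tree_decomposition H F T
     \<and> (\<forall>X\<in>F. strong_tree_decomposition k (induced H X) (S X))
     \<and> (\<forall>X Y. {X, Y} \<in> edges T \<longrightarrow> forest (induced H (X \<inter> Y)))
     \<and> (\<forall>X Y. {X, Y} \<in> edges T \<longrightarrow>
          (\<exists>D1 D2 \<phi>. min_subdecomp (S X) (X \<inter> Y) D1 \<and> min_subdecomp (S Y) (X \<inter> Y) D2
             \<and> sdecomp_iso \<phi> (induced H (\<Union>(bags D1))) D1 (induced H (\<Union>(bags D2))) D2
             \<and> (\<forall>v \<in> X \<inter> Y. \<phi> v = v))))"

definition strongly_tree_decomposable :: "nat \<Rightarrow> 'a ugraph \<Rightarrow> bool" where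
  "strongly_tree_decomposable k H \<longleftrightarrow> (\<exists>D. strong_tree_decomposition k H D)"

end

theory Submission
  imports Defs "HOL-Probability.Probability"
begin

text \<open>Discard the isolated vertices of \<open>G\<close>, let \<open>M = 2 |E(G)|\<close> and let \<open>\<pi>(x) = deg x / M\<close> be the
  stationary distribution of the random walk on \<open>G\<close>. To a homomorphism \<open>f\<close> from \<open>H\<close> give the weight
  \<open>\<Prod>\<^sub>v \<pi>(f v) \<cdot> \<Prod>\<^sub>u\<^sub>v 1 / (M \<pi>(f u) \<pi>(f v))\<close> over the vertices and edges of \<open>H\<close>. If \<open>H\<close> is a forest
  this is a probability distribution on the homomorphisms, and for every \<open>H\<close> it factorises over tree
  decompositions. By recursion on the level, each strong tree decomposition of \<open>H\<close> carries a
  distribution \<open>\<mu>\<close> on the homomorphisms: glue the distributions of the bags along the tree, making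
  them conditionally independent given the separators. The glued distribution depends only on the
  bags and not on the tree, so it is invariant under isomorphisms of decompositions, and its marginal on a
  subtree is the distribution of that subtree. Hence the isomorphisms between minimum
  sub-decompositions say exactly that adjacent bags have the same marginal on their separator.

  The relative entropy of \<open>\<mu>\<close> with respect to the weight is at most 0: it is the sum over the bags
  minus the sum over the separators, and the latter terms are nonnegative by Gibbs' inequality,
  as the separators are forests. As every vertex has marginal \<open>\<pi>\<close>, this bounds the entropy of \<open>\<mu>\<close>
  from below by \<open>|E(H)| log M - (2|E(H)| - |V(H)|) h(\<pi>)\<close>, where \<open>h(\<pi>) \<le> log |V(G)|\<close>. The isolated
  vertices of \<open>H\<close>, for which the last estimate goes the wrong way, contribute a factor \<open>|V(G)|\<close> each.\<close>

section \<open>Paths and trees\<close>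

lemma verts_induced [simp]: "verts (induced G X) = X"
  and edges_induced [simp]: "edges (induced G X) = {e \<in> edges G. e \<subseteq> X}"
  by (simp_all add: induced_def)

lemma simple_graph_induced: "simple_graph G \<Longrightarrow> X \<subseteq> verts G \<Longrightarrow> simple_graph (induced G X)"
  by (auto simp: simple_graph_def intro: finite_subset)

lemma induced_induced [simp]: "U \<subseteq> X \<Longrightarrow> induced (induced G X) U = induced G U"
  by (auto simp: induced_def)

lemma induced_verts: "simple_graph G \<Longrightarrow> induced G (verts G) = G"
  by (cases G) (auto simp: induced_def simple_graph_def)

lemma finite_edges: "simple_graph G \<Longrightarrow> finite (edges G)"
  by (rule finite_subset[of _ "Pow (verts G)"]) (auto simp: simple_graph_def)

lemma edge_neq: "simple_graph G \<Longrightarrow> {u, v} \<in> edges G \<Longrightarrow> u \<noteq> v"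
  by (auto simp: simple_graph_def)

lemma edge_verts: "simple_graph G \<Longrightarrow> {u, v} \<in> edges G \<Longrightarrow> u \<in> verts G \<and> v \<in> verts G"
  by (auto simp: simple_graph_def)

lemma edge_pairE:
  assumes "simple_graph G" "e \<in> edges G"
  obtains u v where "e = {u, v}" "u \<noteq> v" "u \<in> verts G" "v \<in> verts G"
  using assms by (force simp: simple_graph_def card_2_iff)

lemma graph_path_mono:
  "graph_path G p \<Longrightarrow> verts G \<subseteq> verts G' \<Longrightarrow> edges G \<subseteq> edges G' \<Longrightarrow> graph_path G' p"
  unfolding graph_path_def by (auto elim!: successively_mono)

lemma path_between_mono:
  "path_between G u p v \<Longrightarrow> verts G \<subseteq> verts G' \<Longrightarrow> edges G \<subseteq> edges G' \<Longrightarrow> path_between G' u p v"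
  unfolding path_between_def using graph_path_mono by blast

lemma graph_path_rev: "graph_path G p \<Longrightarrow> graph_path G (rev p)"
  by (auto simp: graph_path_def insert_commute)

lemma path_between_rev: "path_between G u p v \<Longrightarrow> path_between G v (rev p) u"
  unfolding path_between_def using graph_path_rev
  by (auto simp: hd_rev last_rev graph_path_def)

lemma path_between_snoc:
  assumes "path_between G u p w" "v \<in> verts G" "v \<notin> set p" "{w, v} \<in> edges G"
  shows "path_between G u (p @ [v]) v"
  using assms by (auto simp: path_between_def graph_path_def successively_append_iff)

lemma path_between_single: "v \<in> verts G \<Longrightarrow> path_between G v [v] v"
  by (auto simp: path_between_def graph_path_def)

lemma connected_graph_single: "connected_graph (induced G {v})"
  unfolding connected_graph_def using path_between_single[of v "induced G {v}"] by auto

lemma connected_graph_insert: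
  assumes conn: "connected_graph (induced G U)" and "u \<in> U" and uv: "{u, v} \<in> edges G"
  shows "connected_graph (induced G (insert v U))"
proof (cases "v \<in> U")
  case True
  then show ?thesis using conn by (simp add: insert_absorb)
next
  case False
  let ?G = "induced G (insert v U)"
  have old: "\<exists>p. path_between ?G a p b \<and> set p \<subseteq> U" if "a \<in> U" "b \<in> U" for a b
  proof -
    have "\<exists>p. path_between (induced G U) a p b"
      using conn that by (simp add: connected_graph_def)
    then obtain p where p: "path_between (induced G U) a p b" ..
    moreover from p have "set p \<subseteq> U" by (auto simp: path_between_def graph_path_def)
    moreover from p have "path_between ?G a p b" by (rule path_between_mono) auto
    ultimately show ?thesis by blast
  qed
  have new: "\<exists>p. path_between ?G a p v" if "a \<in> U" for a
  proof -
    obtain p where p: "path_between ?G a p u" "set p \<subseteq> U" using old[OF \<open>a \<in> U\<close> \<open>u \<in> U\<close>] by blast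
    have "path_between ?G a (p @ [v]) v"
      by (rule path_between_snoc[OF p(1)]) (use p(2) False uv \<open>u \<in> U\<close> in auto)
    then show ?thesis by blast
  qed
  have "\<exists>p. path_between ?G a p b" if ab: "a \<in> insert v U" "b \<in> insert v U" for a b
  proof (cases "a = v"; cases "b = v")
    assume "a = v" "b = v"
    then show ?thesis using path_between_single[of v ?G] by auto
  next
    assume "a = v" "b \<noteq> v"
    then obtain p where "path_between ?G b p v" using new ab by blast
    then show ?thesis using path_between_rev[of ?G b p v] \<open>a = v\<close> by metis
  next
    assume "a \<noteq> v" "b = v"
    then show ?thesis using new ab by blast
  next
    assume "a \<noteq> v" "b \<noteq> v"
    then show ?thesis using old[of a b] ab by blast
  qed
  then show ?thesis unfolding connected_graph_def verts_induced by blast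
qed

section \<open>Growing connected vertex sets inside trees\<close>

lemma crossing_edge:
  assumes "graph_path G p" "hd p \<in> U" "last p \<notin> U"
  shows "\<exists>u v. u \<in> U \<and> v \<in> verts G - U \<and> {u, v} \<in> edges G"
  using assms
proof (induction p)
  case (Cons x p)
  show ?case
  proof (cases "p = []")
    case False
    then obtain y q where p: "p = y # q" by (cases p) auto
    show ?thesis
    proof (cases "y \<in> U")
      case True
      then show ?thesis using Cons p by (auto simp: graph_path_def)
    next
      case False
      then show ?thesis using Cons.prems p by (auto simp: graph_path_def)
    qed
  qed (use Cons in auto)
qed (auto simp: graph_path_def)

lemma forest_induced: "forest G \<Longrightarrow> X \<subseteq> verts G \<Longrightarrow> forest (induced G X)"
  unfolding forest_def graph_cycle_def
  by (auto simp: simple_graph_induced dest!: graph_path_mono[of "induced G X" _ G])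

lemma tree_simple_graph: "tree G \<Longrightarrow> simple_graph G"
  by (simp add: tree_def forest_def)

text \<open>Two distinct neighbours of \<open>v\<close> in \<open>U\<close> are joined by a path
  inside \<open>U\<close>, which \<open>v\<close> closes up to a cycle.\<close>

lemma forest_connected_unique_neighbour:
  assumes "forest G" "U \<subseteq> verts G" and conn: "connected_graph (induced G U)"
    and v: "v \<in> verts G - U" and "u \<in> U" "w \<in> U" and uv: "{u, v} \<in> edges G" "{w, v} \<in> edges G"
  shows "w = u"
proof (rule ccontr)
  assume "w \<noteq> u"
  obtain p where p: "path_between (induced G U) w p u"
    using conn \<open>u \<in> U\<close> \<open>w \<in> U\<close> unfolding connected_graph_def by auto
  have p': "path_between G w p u" by (rule path_between_mono[OF p]) (use assms in auto)
  have "set p \<subseteq> U" using p by (auto simp: path_between_def graph_path_def)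
  then have c: "path_between G w (p @ [v]) v"
    by (intro path_between_snoc[OF p']) (use assms in auto)
  \<comment> \<open>The ends of \<open>p\<close> differ, so appending \<open>v\<close> gives the
    three vertices that \<open>graph_cycle\<close> demands.\<close>
  have "length p \<ge> 2"
    using p' \<open>w \<noteq> u\<close> by (cases p; cases "tl p") (auto simp: path_between_def graph_path_def)
  with c uv p' have "graph_cycle G (p @ [v])"
    by (auto simp: graph_cycle_def path_between_def graph_path_def insert_commute)
  then show False using \<open>forest G\<close> by (auto simp: forest_def)
qed

lemma tree_extend:
  assumes T: "tree T" and U: "U \<subset> verts T" and conn: "connected_graph (induced T U)"
  obtains u v where "u \<in> U" "v \<in> verts T - U" "{u, v} \<in> edges T"
    "\<And>w. w \<in> U \<Longrightarrow> {w, v} \<in> edges T \<Longrightarrow> w = u"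
proof -
  obtain a b where "a \<in> U" "b \<in> verts T - U"
    using conn U unfolding connected_graph_def by auto
  then obtain p where "path_between T a p b"
    using T U unfolding tree_def connected_graph_def by blast
  with \<open>a \<in> U\<close> \<open>b \<in> verts T - U\<close> obtain u v
    where uv: "u \<in> U" "v \<in> verts T - U" "{u, v} \<in> edges T"
    using crossing_edge[of T p U] by (auto simp: path_between_def)
  moreover have "w = u" if "w \<in> U" "{w, v} \<in> edges T" for w
    using forest_connected_unique_neighbour[of T U v u w] that T U conn uv by (auto simp: tree_def)
  ultimately show thesis using that by blast
qed

text \<open>A connected vertex set grows to the whole tree by adding vertices with exactly one
  neighbour in the current set. The start \<open>A\<close> is arbitrary, so that a statement about
  the part over \<open>A\<close> can be carried along as an invariant. The rule serves both the
  trees \<open>H\<close> of level 0 and the trees of bags.\<close>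

lemma tree_induct [consumes 3, case_names start insert]:
  assumes T: "tree T" and "A \<subseteq> verts T" and "connected_graph (induced T A)"
    and start: "P A"
    and step: "\<And>U u v. A \<subseteq> U \<Longrightarrow> U \<subseteq> verts T \<Longrightarrow> connected_graph (induced T U) \<Longrightarrow> u \<in> U \<Longrightarrow>
      v \<in> verts T - U \<Longrightarrow> {u, v} \<in> edges T \<Longrightarrow> (\<And>w. w \<in> U \<Longrightarrow> {w, v} \<in> edges T \<Longrightarrow> w = u) \<Longrightarrow>
      P U \<Longrightarrow> P (insert v U)"
  shows "P (verts T)"
proof -
  have fin: "finite (verts T)" using tree_simple_graph[OF T] by (simp add: simple_graph_def)
  have "P U \<Longrightarrow> P (verts T)" if "A \<subseteq> U" "U \<subseteq> verts T" "connected_graph (induced T U)" for U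
    using that
  proof (induction "card (verts T - U)" arbitrary: U rule: less_induct)
    case less
    show ?case
    proof (cases "U = verts T")
      case False
      then have "U \<subset> verts T" using less.prems by blast
      then obtain u v where uv: "u \<in> U" "v \<in> verts T - U" "{u, v} \<in> edges T"
        and uniq: "\<And>w. w \<in> U \<Longrightarrow> {w, v} \<in> edges T \<Longrightarrow> w = u"
        using tree_extend[OF T _ less.prems(4)] by metis
      show ?thesis
      proof (rule less.hyps[of "insert v U"])
        show "card (verts T - insert v U) < card (verts T - U)"
          by (rule psubset_card_mono) (use fin uv in auto)
        show "P (insert v U)" using step[OF less.prems(2,3,4) uv uniq] less.prems(1) by blast
        show "connected_graph (induced T (insert v U))"
          by (rule connected_graph_insert[OF less.prems(4) uv(1,3)])
      qed (use less.prems uv in auto)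
    qed (use less.prems in simp)
  qed
  then show ?thesis using assms by blast
qed

text \<open>The first vertex of a longest path has all its neighbours on the path, by maximality,
  and none beyond the second vertex, by acyclicity. An isolated vertex also qualifies, with
  \<open>u\<close> arbitrary.\<close>

lemma forest_leaf:
  assumes G: "forest G" and ne: "verts G \<noteq> {}"
  obtains v u where "v \<in> verts G" "\<And>w. {w, v} \<in> edges G \<Longrightarrow> w = u"
proof -
  have sg: "simple_graph G" using G by (simp add: forest_def)
  obtain x where x: "x \<in> verts G" using ne by blast
  have "length p \<le> card (verts G)" if "graph_path G p" for p
    using that sg unfolding graph_path_def simple_graph_def
    by (metis card_mono distinct_card)
  then have "\<exists>p. graph_path G p \<and> (\<forall>q. graph_path G q \<longrightarrow> length q \<le> length p)"
    using path_between_single[OF x]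
    by (intro ex_has_greatest_nat[where b = "card (verts G) + 1" and k = "[x]"])
      (auto simp: path_between_def less_Suc_eq_le)
  then obtain p where p: "graph_path G p" and max: "\<And>q. graph_path G q \<Longrightarrow> length q \<le> length p"
    by blast
  obtain v q where pq: "p = v # q" using p by (cases p) (auto simp: graph_path_def)
  have nbr: "w \<in> set q" if "{w, v} \<in> edges G" for w
  proof (rule ccontr)
    assume "w \<notin> set q"
    then have "graph_path G (w # p)"
      using p that edge_neq[OF sg that] edge_verts[OF sg that] unfolding pq graph_path_def by auto
    then show False using max[of "w # p"] by simp
  qed
  \<comment> \<open>For empty \<open>q\<close> the value \<open>hd q\<close> is unspecified, but
    then \<open>nbr\<close> excludes every \<open>w\<close>.\<close>
  have "w = hd q" if w: "{w, v} \<in> edges G" for w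
  proof (rule ccontr)
    assume "w \<noteq> hd q"
    with nbr[OF w] obtain q1 q2 where q: "q = q1 @ w # q2" "q1 \<noteq> []"
      by (metis append_Nil list.sel(1) split_list)
    have "graph_path G (v # q1 @ [w])"
      using p q(2) unfolding pq q(1) graph_path_def
      by (auto simp: successively_append_iff successively_Cons)
    then have "graph_cycle G (v # q1 @ [w])"
      using q w by (auto simp: graph_cycle_def Suc_le_eq)
    then show False using G by (auto simp: forest_def)
  qed
  moreover have "v \<in> verts G" using p by (auto simp: pq graph_path_def)
  ultimately show thesis using that by blast
qed

text \<open>The conditional allows for a new vertex with no neighbour in \<open>U\<close>, which
  occurs when a forest is built up.\<close>

lemma edges_insert_subset:
  assumes G: "simple_graph G" and uniq: "\<And>w. w \<in> U \<Longrightarrow> {w, v} \<in> edges G \<Longrightarrow> w = u"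
  shows "{e \<in> edges G. e \<subseteq> insert v U} =
    {e \<in> edges G. e \<subseteq> U} \<union> (if u \<in> U \<and> {u, v} \<in> edges G then {{u, v}} else {})"
proof -
  have "u \<in> U \<and> e = {u, v} \<or> e \<subseteq> U" if e: "e \<in> edges G" "e \<subseteq> insert v U" for e
  proof -
    obtain a b where ab: "e = {a, b}" "a \<noteq> b" by (rule edge_pairE[OF G e(1)])
    show ?thesis
    proof (cases "a = v \<or> b = v")
      case True
      then obtain w where w: "e = {w, v}" "w \<noteq> v" using ab by (metis insert_commute)
      then have "w \<in> U" using e by auto
      moreover have "w = u" using \<open>w \<in> U\<close> w e by (intro uniq) auto
      ultimately show ?thesis using w by simp
    qed (use ab e in auto)
  qed
  then show ?thesis by auto
qed

lemma tree_card_edges: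
  assumes T: "tree T"
  shows "card (edges T) + 1 = card (verts T)"
proof -
  note sg = tree_simple_graph[OF T]
  obtain v0 where v0: "v0 \<in> verts T" using T by (auto simp: tree_def connected_graph_def)
  have "card {e \<in> edges T. e \<subseteq> verts T} + 1 = card (verts T)"
    using T _ connected_graph_single
  proof (rule tree_induct[where A = "{v0}"])
    have "{e \<in> edges T. e \<subseteq> {v0}} = {}"
      using sg by (auto simp: simple_graph_def subset_singleton_iff)
    then show "card {e \<in> edges T. e \<subseteq> {v0}} + 1 = card {v0}"
      by simp
  next
    fix U u v
    assume *: "U \<subseteq> verts T" "u \<in> U" "v \<in> verts T - U" "{u, v} \<in> edges T"
      "\<And>w. w \<in> U \<Longrightarrow> {w, v} \<in> edges T \<Longrightarrow> w = u" "card {e \<in> edges T. e \<subseteq> U} + 1 = card U"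
    have "{e \<in> edges T. e \<subseteq> insert v U} = insert {u, v} {e \<in> edges T. e \<subseteq> U}"
      using edges_insert_subset[OF sg *(5)] *(2,4) by simp
    moreover have "finite U" using *(1) sg by (auto simp: simple_graph_def intro: finite_subset)
    ultimately show "card {e \<in> edges T. e \<subseteq> insert v U} + 1 = card (insert v U)"
      using *(3,6) finite_edges[OF sg] by simp
  qed (use v0 in auto)
  moreover have "{e \<in> edges T. e \<subseteq> verts T} = edges T" using sg by (auto simp: simple_graph_def)
  ultimately show ?thesis by simp
qed

section \<open>Marginals and gluing of distributions\<close>

text \<open>Everything outside \<open>U\<close> becomes \<open>undefined\<close>, so marginals of
  different distributions on the same set can be compared by plain equality.\<close>

definition marg :: "'a set \<Rightarrow> ('a \<Rightarrow> 'b) pmf \<Rightarrow> ('a \<Rightarrow> 'b) pmf" where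
  "marg U \<mu> = map_pmf (\<lambda>f. restrict f U) \<mu>"

lemma marg_marg: "U \<subseteq> X \<Longrightarrow> marg U (marg X \<mu>) = marg U \<mu>"
  by (simp add: marg_def map_pmf_comp Int_absorb1)

lemma marg_extensional: "set_pmf \<mu> \<subseteq> extensional V \<Longrightarrow> marg V \<mu> = \<mu>"
  unfolding marg_def by (rule map_pmf_idI) (auto simp: extensional_restrict)

lemma set_marg: "set_pmf (marg U \<mu>) = (\<lambda>f. restrict f U) ` set_pmf \<mu>"
  by (simp add: marg_def)

lemma set_marg_extensional: "set_pmf (marg U \<mu>) \<subseteq> extensional U"
  by (auto simp: set_marg)

lemma expectation_marg:
  fixes \<phi> :: "('a \<Rightarrow> 'b) \<Rightarrow> real"
  shows "measure_pmf.expectation (marg U \<mu>) \<phi> = measure_pmf.expectation \<mu> (\<lambda>f. \<phi> (restrict f U))"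
  by (simp add: marg_def)

lemma pmf_marg_pos: "f \<in> set_pmf \<mu> \<Longrightarrow> pmf (marg U \<mu>) (restrict f U) > 0"
  by (intro pmf_positive) (simp add: set_marg)

lemma pmf_eqI_extensional:
  assumes "set_pmf \<mu> \<subseteq> extensional V" "set_pmf \<nu> \<subseteq> extensional V"
    and "\<And>f. f \<in> extensional V \<Longrightarrow> pmf \<mu> f = pmf \<nu> f"
  shows "\<mu> = \<nu>"
proof (rule pmf_eqI)
  fix f show "pmf \<mu> f = pmf \<nu> f"
  proof (cases "f \<in> extensional V")
    case False
    then have "f \<notin> set_pmf \<mu>" "f \<notin> set_pmf \<nu>" using assms(1,2) by auto
    then show ?thesis by (simp add: set_pmf_iff)
  qed (simp add: assms(3))
qed

section \<open>Gluing two distributions along the overlap of their index sets\<close>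

definition merge :: "'a set \<Rightarrow> 'a set \<Rightarrow> ('a \<Rightarrow> 'b) \<Rightarrow> ('a \<Rightarrow> 'b) \<Rightarrow> 'a \<Rightarrow> 'b" where
  "merge A Z f g = (\<lambda>x\<in>A \<union> Z. if x \<in> A then f x else g x)"

lemma merge_eq_iff:
  assumes "f \<in> extensional A" "g \<in> extensional Z" "restrict g (A \<inter> Z) = restrict f (A \<inter> Z)"
    and "h \<in> extensional (A \<union> Z)"
  shows "merge A Z f g = h \<longleftrightarrow> f = restrict h A \<and> g = restrict h Z"
proof -
  have eq: "g x = f x" if "x \<in> A" "x \<in> Z" for x
    using fun_cong[OF assms(3), of x] that by simp
  show ?thesis
  proof
    assume h: "merge A Z f g = h"
    show "f = restrict h A \<and> g = restrict h Z"
      using assms(1,2) eq unfolding h[symmetric] merge_def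
      by (auto simp: fun_eq_iff restrict_def extensional_def)
  next
    assume h: "f = restrict h A \<and> g = restrict h Z"
    show "merge A Z f g = h"
      using assms(4) unfolding merge_def by (auto simp: fun_eq_iff restrict_def extensional_def h)
  qed
qed

text \<open>\<open>K\<close> is a Markov kernel: \<open>f\<close> is drawn first, then
  \<open>g\<close> from \<open>K f\<close>. Two kernels occur below: conditioning on agreement with
  \<open>f\<close> in \<open>glue_pmf\<close>, and a random walk step in
  \<open>law_extend\<close>.\<close>

definition join_pmf ::
    "'a set \<Rightarrow> 'a set \<Rightarrow> ('a \<Rightarrow> 'b) pmf \<Rightarrow> (('a \<Rightarrow> 'b) \<Rightarrow> ('a \<Rightarrow> 'b) pmf) \<Rightarrow> ('a \<Rightarrow> 'b) pmf" where
  "join_pmf A Z \<mu> K = bind_pmf \<mu> (\<lambda>f. map_pmf (merge A Z f) (K f))"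

context
  fixes A Z :: "'a set" and \<mu> :: "('a \<Rightarrow> 'b) pmf" and K
  assumes \<mu>: "set_pmf \<mu> \<subseteq> extensional A"
    and K: "\<And>f. f \<in> set_pmf \<mu> \<Longrightarrow>
      set_pmf (K f) \<subseteq> {g \<in> extensional Z. restrict g (A \<inter> Z) = restrict f (A \<inter> Z)}"
begin

lemma set_join_pmf: "set_pmf (join_pmf A Z \<mu> K) \<subseteq> extensional (A \<union> Z)"
  by (auto simp: join_pmf_def merge_def)

lemma merge_restrict:
  assumes "f \<in> set_pmf \<mu>" "g \<in> set_pmf (K f)"
  shows "restrict (merge A Z f g) A = f" "restrict (merge A Z f g) Z = g"
proof -
  have "merge A Z f g = merge A Z f g \<longleftrightarrow>
      f = restrict (merge A Z f g) A \<and> g = restrict (merge A Z f g) Z"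
    by (rule merge_eq_iff) (use assms \<mu> K[OF assms(1)] in \<open>auto simp: merge_def\<close>)
  then show "restrict (merge A Z f g) A = f" "restrict (merge A Z f g) Z = g" by simp_all
qed

lemma marg_join_pmf_left: "marg A (join_pmf A Z \<mu> K) = \<mu>"
proof -
  have "marg A (join_pmf A Z \<mu> K) = bind_pmf \<mu> (\<lambda>f. map_pmf (\<lambda>g. restrict (merge A Z f g) A) (K f))"
    by (simp add: marg_def join_pmf_def map_bind_pmf map_pmf_comp)
  also have "\<dots> = bind_pmf \<mu> return_pmf"
  proof (rule bind_pmf_cong[OF refl])
    fix f assume "f \<in> set_pmf \<mu>"
    then have "map_pmf (\<lambda>g. restrict (merge A Z f g) A) (K f) = map_pmf (\<lambda>_. f) (K f)"
      by (intro map_pmf_cong) (auto simp: merge_restrict)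
    then show "map_pmf (\<lambda>g. restrict (merge A Z f g) A) (K f) = return_pmf f"
      by (simp add: map_pmf_const)
  qed
  finally show ?thesis by (simp add: bind_return_pmf')
qed

lemma marg_join_pmf_right: "marg Z (join_pmf A Z \<mu> K) = bind_pmf \<mu> K"
proof -
  have "marg Z (join_pmf A Z \<mu> K) = bind_pmf \<mu> (\<lambda>f. map_pmf (\<lambda>g. restrict (merge A Z f g) Z) (K f))"
    by (simp add: marg_def join_pmf_def map_bind_pmf map_pmf_comp)
  also have "\<dots> = bind_pmf \<mu> K"
    by (intro bind_pmf_cong refl map_pmf_idI) (simp add: merge_restrict)
  finally show ?thesis .
qed

text \<open>A merged function determines both its parts, so only \<open>f = restrict h A\<close>
  contributes to the mass of the mixture at \<open>h\<close>.\<close>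

lemma pmf_join_pmf:
  assumes h: "h \<in> extensional (A \<union> Z)"
  shows "pmf (join_pmf A Z \<mu> K) h = pmf \<mu> (restrict h A) * pmf (K (restrict h A)) (restrict h Z)"
proof -
  let ?c = "pmf (K (restrict h A)) (restrict h Z)"
  have *: "pmf (map_pmf (merge A Z f) (K f)) h = indicator {restrict h A} f * ?c"
    if f: "f \<in> set_pmf \<mu>" for f
  proof -
    have "pmf (map_pmf (merge A Z f) (K f)) h
        = measure (K f) (merge A Z f -` {h} \<inter> set_pmf (K f))"
      by (simp add: pmf_map measure_Int_set_pmf)
    also have "merge A Z f -` {h} \<inter> set_pmf (K f)
        = {g. f = restrict h A \<and> g = restrict h Z} \<inter> set_pmf (K f)"
      using merge_eq_iff[OF _ _ _ h, of f] \<mu> K[OF f] f by auto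
    also have "measure (K f) \<dots> = indicator {restrict h A} f * ?c"
      by (cases "f = restrict h A") (simp_all add: measure_Int_set_pmf measure_pmf_single)
    finally show ?thesis .
  qed
  have "pmf (join_pmf A Z \<mu> K) h = measure_pmf.expectation \<mu> (\<lambda>f. pmf (map_pmf (merge A Z f) (K f)) h)"
    by (simp add: join_pmf_def pmf_bind)
  also have "\<dots> = measure_pmf.expectation \<mu> (\<lambda>f. indicator {restrict h A} f * ?c)"
    by (rule integral_cong_AE) (auto simp: AE_measure_pmf_iff *)
  also have "\<dots> = pmf \<mu> (restrict h A) * ?c"
    by (simp add: measure_pmf_single)
  finally show ?thesis .
qed

end

text \<open>The conditionally independent coupling: draw \<open>f\<close> from \<open>\<mu>\<close>,
  then \<open>g\<close> from \<open>\<nu>\<close> conditioned on agreeing with \<open>f\<close> on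
  \<open>A \<inter> Z\<close>. Equality of the marginals on the overlap is what gives
  \<open>g\<close> the law \<open>\<nu>\<close>.\<close>

lemma glue_pmf:
  fixes \<mu> \<nu> :: "('a \<Rightarrow> 'b) pmf"
  assumes \<mu>: "set_pmf \<mu> \<subseteq> extensional A" and \<nu>: "set_pmf \<nu> \<subseteq> extensional Z"
    and eq: "marg (A \<inter> Z) \<mu> = marg (A \<inter> Z) \<nu>"
  obtains \<kappa> where "set_pmf \<kappa> \<subseteq> extensional (A \<union> Z)" "marg A \<kappa> = \<mu>" "marg Z \<kappa> = \<nu>"
    "\<And>h. h \<in> extensional (A \<union> Z) \<Longrightarrow> pmf \<kappa> h =
      pmf \<mu> (restrict h A) * pmf \<nu> (restrict h Z) / pmf (marg (A \<inter> Z) \<nu>) (restrict h (A \<inter> Z))"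
proof -
  let ?S = "A \<inter> Z"
  define K where "K = (\<lambda>f. cond_pmf \<nu> {g. restrict f ?S = restrict g ?S})"
  have ne: "set_pmf \<nu> \<inter> {g. restrict f ?S = restrict g ?S} \<noteq> {}" if "f \<in> set_pmf \<mu>" for f
  proof -
    have "restrict f ?S \<in> set_pmf (marg ?S \<nu>)" using that by (simp add: eq[symmetric] set_marg)
    then show ?thesis by (auto simp: set_marg)
  qed
  have ne': "set_pmf \<mu> \<inter> {f. restrict f ?S = restrict g ?S} \<noteq> {}" if "g \<in> set_pmf \<nu>" for g
  proof -
    have "restrict g ?S \<in> set_pmf (marg ?S \<mu>)" using that by (simp add: eq set_marg)
    then obtain f where "f \<in> set_pmf \<mu>" "restrict g ?S = restrict f ?S"
      unfolding set_marg by blast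
    then show ?thesis by auto
  qed
  have meas: "measure \<nu> {g. restrict f ?S = restrict g ?S} = pmf (marg ?S \<nu>) (restrict f ?S)" for f
    unfolding marg_def pmf_map by (rule arg_cong[where f = "measure \<nu>"]) auto
  have meas': "measure \<mu> {f. restrict f ?S = restrict g ?S} = pmf (marg ?S \<nu>) (restrict g ?S)" for g
    unfolding eq[symmetric] unfolding marg_def pmf_map
    by (rule arg_cong[where f = "measure \<mu>"]) auto
  have K: "set_pmf (K f) \<subseteq> {g \<in> extensional Z. restrict g ?S = restrict f ?S}"
    if "f \<in> set_pmf \<mu>" for f
    using \<nu> ne[OF that] by (auto simp: K_def)
  have bind: "bind_pmf \<mu> K = \<nu>"
    unfolding K_def by (rule bind_cond_pmf_cancel) (use ne ne' in \<open>auto simp: meas meas'\<close>)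
  show thesis
  proof (rule that[of "join_pmf A Z \<mu> K"])
    show "set_pmf (join_pmf A Z \<mu> K) \<subseteq> extensional (A \<union> Z)"
      by (rule set_join_pmf[OF \<mu> K])
    show "marg A (join_pmf A Z \<mu> K) = \<mu>" by (rule marg_join_pmf_left[OF \<mu> K])
    show "marg Z (join_pmf A Z \<mu> K) = \<nu>" using marg_join_pmf_right[OF \<mu> K] bind by simp
  next
    fix h :: "'a \<Rightarrow> 'b"
    assume h: "h \<in> extensional (A \<union> Z)"
    show "pmf (join_pmf A Z \<mu> K) h =
      pmf \<mu> (restrict h A) * pmf \<nu> (restrict h Z) / pmf (marg ?S \<nu>) (restrict h ?S)"
    proof (cases "restrict h A \<in> set_pmf \<mu>")
      case True
      have "pmf (K (restrict h A)) (restrict h Z)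
          = pmf \<nu> (restrict h Z) / pmf (marg ?S \<nu>) (restrict h ?S)"
      proof -
        have r: "restrict (restrict h A) ?S = restrict h ?S" "restrict (restrict h Z) ?S = restrict h ?S"
          by (simp_all add: Int_absorb1)
        show ?thesis
          using pmf_cond[OF ne[OF True], of "restrict h Z"] meas[of "restrict h A"]
          unfolding K_def r by (simp add: Int_absorb1)
      qed
      then show ?thesis using pmf_join_pmf[OF \<mu> K h] by simp
    next
      \<comment> \<open>Every \<open>h\<close> with vanishing denominator falls under this case;
        both sides are 0.\<close>
      case False
      then have "pmf \<mu> (restrict h A) = 0" by (simp add: set_pmf_iff)
      then show ?thesis using pmf_join_pmf[OF \<mu> K h] by simp
    qed
  qed
qed

section \<open>Tree-indexed random walks\<close>

lemma finite_Hom: "simple_graph H \<Longrightarrow> simple_graph G \<Longrightarrow> finite (Hom H G)"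
  unfolding Hom_def simple_graph_def
  by (rule finite_subset[of _ "verts H \<rightarrow>\<^sub>E verts G"]) (auto intro: finite_PiE)

lemma Hom_restrict: "f \<in> Hom H G \<Longrightarrow> U \<subseteq> verts H \<Longrightarrow> restrict f U \<in> Hom (induced H U) G"
  by (auto simp: Hom_def)

lemma Hom_extensional: "f \<in> Hom H G \<Longrightarrow> f \<in> extensional (verts H)"
  by (auto simp: Hom_def PiE_def)

text \<open>Without isolated vertices every random walk step is possible, and the stationary
  distribution is positive on all vertices, so that its logarithm is meaningful there.\<close>

locale target_graph =
  fixes G :: "'b ugraph"
  assumes simple: "simple_graph G" and nonempty: "verts G \<noteq> {}"
    and no_isolated: "\<And>x. x \<in> verts G \<Longrightarrow> \<exists>y. {x, y} \<in> edges G"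
begin

definition arcs :: "('b \<times> 'b) set" where "arcs = {(x, y). {x, y} \<in> edges G}"
definition nbrs :: "'b \<Rightarrow> 'b set" where "nbrs x = {y. {x, y} \<in> edges G}"
text \<open>This is the stationary distribution of the simple random walk, with mass deg x / (2
  |E(G)|) at x.\<close>

definition stat :: "'b pmf" where "stat = map_pmf fst (pmf_of_set arcs)"
definition lnpi :: "'b \<Rightarrow> real" where "lnpi x = ln (pmf stat x)"

lemma finite_arcs: "finite arcs"
proof (rule finite_subset)
  show "arcs \<subseteq> verts G \<times> verts G" using edge_verts[OF simple] by (auto simp: arcs_def)
qed (use simple in \<open>auto simp: simple_graph_def\<close>)

lemma arcs_nonempty: "arcs \<noteq> {}"
  using nonempty no_isolated by (auto simp: arcs_def)

lemma finite_nbrs: "finite (nbrs x)"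
proof (rule finite_subset)
  show "nbrs x \<subseteq> verts G" using edge_verts[OF simple] by (auto simp: nbrs_def)
qed (use simple in \<open>auto simp: simple_graph_def\<close>)

lemma set_stat: "set_pmf stat = verts G"
proof -
  have "set_pmf stat = fst ` arcs"
    by (simp add: stat_def finite_arcs arcs_nonempty)
  also have "\<dots> = verts G"
    using edge_verts[OF simple] no_isolated by (force simp: arcs_def)
  finally show ?thesis .
qed

lemma pmf_stat: "pmf stat x = real (card (nbrs x)) / real (card arcs)"
proof -
  have "pmf stat x = card (arcs \<inter> fst -` {x}) / card arcs"
    unfolding stat_def pmf_map by (simp add: measure_pmf_of_set finite_arcs arcs_nonempty)
  also have "arcs \<inter> fst -` {x} = Pair x ` nbrs x" by (auto simp: arcs_def nbrs_def)
  also have "card \<dots> = card (nbrs x)" by (simp add: card_image inj_on_def)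
  finally show ?thesis .
qed

lemma pmf_stat_pos: "x \<in> verts G \<Longrightarrow> pmf stat x > 0"
  by (rule pmf_positive) (simp add: set_stat)

lemma exp_lnpi: "x \<in> verts G \<Longrightarrow> exp (lnpi x) = pmf stat x"
  by (simp add: lnpi_def pmf_stat_pos)

lemma card_arcs_pos: "real (card arcs) > 0"
  using finite_arcs arcs_nonempty by (simp add: card_gt_0_iff)

text \<open>The logarithm of the homomorphism weight, with M = \<open>card arcs\<close>. Logarithms
  turn the factorisation over bags into additivity and can be integrated term by term.\<close>

definition ln_wt :: "'a ugraph \<Rightarrow> ('a \<Rightarrow> 'b) \<Rightarrow> real" where
  "ln_wt H f = (\<Sum>v\<in>verts H. lnpi (f v)) +
     (\<Sum>e\<in>edges H. - ln (card arcs) - (\<Sum>v\<in>e. lnpi (f v)))"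

text \<open>That the weights already sum to 1 is a property of \<open>H\<close>: such a
  \<open>\<rho>\<close> is unique, and it exists for every forest by
  \<open>forest_law\<close>.\<close>

definition law :: "'a ugraph \<Rightarrow> ('a \<Rightarrow> 'b) pmf \<Rightarrow> bool" where
  "law H \<rho> \<longleftrightarrow> set_pmf \<rho> \<subseteq> Hom H G \<and> (\<forall>f\<in>Hom H G. pmf \<rho> f = exp (ln_wt H f))"

lemma ln_wt_cong:
  assumes "simple_graph H" "\<And>v. v \<in> verts H \<Longrightarrow> f v = g v"
  shows "ln_wt H f = ln_wt H g"
proof -
  have "(\<Sum>v\<in>e. lnpi (f v)) = (\<Sum>v\<in>e. lnpi (g v))" if "e \<in> edges H" for e
  proof (rule sum.cong)
    fix v assume "v \<in> e"
    then have "v \<in> verts H" using that assms(1) by (auto simp: simple_graph_def)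
    then show "lnpi (f v) = lnpi (g v)" using assms(2) by simp
  qed simp
  then show ?thesis unfolding ln_wt_def using assms(2) by simp
qed

lemma ln_wt_restrict:
  "simple_graph H \<Longrightarrow> U \<subseteq> verts H \<Longrightarrow> ln_wt (induced H U) (restrict f U) = ln_wt (induced H U) f"
  by (rule ln_wt_cong) (auto intro: simple_graph_induced)

lemma law_unique: "law H \<rho> \<Longrightarrow> law H \<rho>' \<Longrightarrow> \<rho> = \<rho>'"
  unfolding law_def by (intro pmf_eqI) (metis pmf_eq_0_set_pmf subset_iff)

text \<open>A vertex without neighbours in \<open>U\<close> multiplies the weight by \<pi>(f v), a
  fresh stationary sample. A single neighbour \<open>u\<close> multiplies it by 1 / (M \<pi>(f u)) =
  1 / deg(f u), a step of the random walk. Either way the new weight is again a probability and the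
  old distribution is its marginal.\<close>

lemma law_extend:
  fixes H :: "'a ugraph"
  assumes H: "simple_graph H" and U: "U \<subseteq> verts H" and v: "v \<in> verts H - U"
    and law: "law (induced H U) \<rho>"
    and uniq: "\<And>w. w \<in> U \<Longrightarrow> {w, v} \<in> edges H \<Longrightarrow> w = u"
  obtains \<nu> where "law (induced H (insert v U)) \<nu>" "marg U \<nu> = \<rho>"
proof -
  let ?H0 = "induced H U" and ?H1 = "induced H (insert v U)"
  define adj where "adj \<longleftrightarrow> u \<in> U \<and> {u, v} \<in> edges H"
  define q where "q = (\<lambda>f :: 'a \<Rightarrow> 'b. if adj then pmf_of_set (nbrs (f u)) else stat)"
  define pt where "pt = (\<lambda>y :: 'b. \<lambda>x\<in>{v}. y)"
  define K where "K = (\<lambda>f. map_pmf pt (q f))"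
  define \<nu> where "\<nu> = join_pmf U {v} \<rho> K"
  have \<rho>: "set_pmf \<rho> \<subseteq> Hom ?H0 G" and pmf_\<rho>: "\<And>f. f \<in> Hom ?H0 G \<Longrightarrow> pmf \<rho> f = exp (ln_wt ?H0 f)"
    using law by (auto simp: law_def)
  have ext: "set_pmf \<rho> \<subseteq> extensional U" using \<rho> by (auto dest!: Hom_extensional)
  have Uv: "U \<inter> {v} = {}" using v by auto
  have K: "set_pmf (K f) \<subseteq> {g \<in> extensional {v}. restrict g (U \<inter> {v}) = restrict f (U \<inter> {v})}" for f
    unfolding Uv by (auto simp: K_def pt_def)
  have fv: "f u \<in> verts G" if "f \<in> Hom ?H0 G" adj for f
    using that by (auto simp: Hom_def adj_def)
  have nb: "nbrs x \<noteq> {}" if "x \<in> verts G" for x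
    using no_isolated[OF that] by (auto simp: nbrs_def)
  have finU: "finite U" using U H by (auto simp: simple_graph_def intro: finite_subset)
  have edges: "{e \<in> edges H. e \<subseteq> insert v U} = {e \<in> edges H. e \<subseteq> U} \<union> (if adj then {{u, v}} else {})"
    unfolding adj_def by (rule edges_insert_subset[OF H uniq])
  \<comment> \<open>If \<open>v\<close> has a neighbour, its vertex term \<open>lnpi (h v)\<close>
    cancels against the same term of the edge \<open>{u, v}\<close>.\<close>
  have wt: "ln_wt ?H1 h = ln_wt ?H0 h + (if adj then - ln (card arcs) - lnpi (h u) else lnpi (h v))" for h
  proof (cases adj)
    case True
    then have "u \<noteq> v" "{u, v} \<notin> {e \<in> edges H. e \<subseteq> U}" using v by (auto simp: adj_def)
    then show ?thesis
      using True finU v finite_edges[OF H] unfolding ln_wt_def by (simp add: edges)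
  next
    case False
    then show ?thesis using finU v unfolding ln_wt_def by (simp add: edges)
  qed
  have set_\<nu>: "set_pmf \<nu> \<subseteq> Hom ?H1 G"
  proof
    fix h assume "h \<in> set_pmf \<nu>"
    then obtain f y where f: "f \<in> Hom ?H0 G" and y: "y \<in> set_pmf (q f)"
      and h: "h = merge U {v} f (pt y)"
      using \<rho> by (auto simp: \<nu>_def join_pmf_def K_def)
    have hv: "h v = y" and hU: "\<And>x. x \<in> U \<Longrightarrow> h x = f x"
      using v by (auto simp: h merge_def pt_def)
    have y': "y \<in> verts G \<and> (adj \<longrightarrow> {f u, y} \<in> edges G)"
    proof (cases adj)
      case True
      then have "y \<in> nbrs (f u)" using y fv[OF f True] nb by (simp add: q_def finite_nbrs)
      then show ?thesis using edge_verts[OF simple] by (auto simp: nbrs_def)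
    qed (use y in \<open>simp add: q_def set_stat\<close>)
    have "h \<in> insert v U \<rightarrow>\<^sub>E verts G"
      using y' f hv hU by (auto simp: Hom_def h merge_def extensional_def)
    moreover have "{h a, h b} \<in> edges G" if e: "{a, b} \<in> edges H" "a \<in> insert v U" "b \<in> insert v U" for a b
    proof -
      consider "a \<in> U" "b \<in> U" | "a = v" "b \<in> U" | "a \<in> U" "b = v" | "a = b" using e by auto
      then show ?thesis
      proof cases
        case 1
        then show ?thesis using f e hU by (auto simp: Hom_def)
      next
        case 2
        then have "b = u" using uniq[of b] e by (simp add: insert_commute)
        then show ?thesis using 2 e y' hv hU by (auto simp: adj_def insert_commute)
      next
        case 3
        then have "a = u" using uniq[of a] e by simp
        then show ?thesis using 3 e y' hv hU by (auto simp: adj_def)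
      next
        case 4
        then show ?thesis using edge_neq[OF H e(1)] by simp
      qed
    qed
    ultimately show "h \<in> Hom ?H1 G" using edge_neq[OF H, of v v] by (auto simp: Hom_def)
  qed
  have "pmf \<nu> h = exp (ln_wt ?H1 h)" if h: "h \<in> Hom ?H1 G" for h
  proof -
    have hE: "h \<in> extensional (U \<union> {v})" using Hom_extensional[OF h] by simp
    have hU: "restrict h U \<in> Hom ?H0 G"
      using Hom_restrict[OF h, of U] by (auto simp: subset_insertI)
    have "pmf \<nu> h = pmf \<rho> (restrict h U) * pmf (K (restrict h U)) (restrict h {v})"
      unfolding \<nu>_def by (rule pmf_join_pmf[OF ext K hE])
    moreover have "pmf \<rho> (restrict h U) = exp (ln_wt ?H0 h)"
      using pmf_\<rho>[OF hU] ln_wt_restrict[OF H U] by simp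
    moreover have "pmf (K (restrict h U)) (restrict h {v}) = pmf (q (restrict h U)) (h v)"
    proof -
      have "restrict h {v} = pt (h v)" by (auto simp: pt_def restrict_def)
      moreover have "inj pt" by (rule injI) (metis pt_def restrict_apply' singletonI)
      ultimately show ?thesis unfolding K_def by (simp add: pmf_map_inj')
    qed
    moreover have "pmf (q (restrict h U)) (h v)
        = exp (if adj then - ln (card arcs) - lnpi (h u) else lnpi (h v))"
    proof (cases adj)
      case True
      then have hu: "restrict h U u = h u" "h u \<in> verts G" and e: "{h u, h v} \<in> edges G"
        using h by (auto simp: adj_def Hom_def)
      then have "pmf (q (restrict h U)) (h v) = 1 / card (nbrs (h u))"
        using True nb by (simp add: q_def pmf_of_set finite_nbrs) (simp add: nbrs_def)
      \<comment> \<open>By \<open>pmf_stat\<close> the factor \<open>card arcs\<close>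
        cancels.\<close>
      also have "\<dots> = exp (- ln (card arcs) - lnpi (h u))"
        using hu card_arcs_pos by (simp add: exp_diff exp_minus exp_lnpi pmf_stat field_simps)
      finally show ?thesis using True by simp
    next
      case False
      have "h v \<in> verts G" using h by (auto simp: Hom_def)
      then show ?thesis using False by (simp add: q_def exp_lnpi)
    qed
    ultimately show ?thesis by (simp add: wt exp_add)
  qed
  with set_\<nu> have "law ?H1 \<nu>" by (simp add: law_def)
  moreover have "marg U \<nu> = \<rho>" unfolding \<nu>_def by (rule marg_join_pmf_left[OF ext K])
  ultimately show thesis using that by blast
qed

lemma law_empty: "simple_graph H \<Longrightarrow> law (induced H {}) (return_pmf (\<lambda>_. undefined))"
  by (auto simp: law_def Hom_def ln_wt_def simple_graph_def)

lemma forest_law: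
  assumes "forest H"
  shows "\<exists>\<rho>. law H \<rho>"
  using assms
proof (induction "card (verts H)" arbitrary: H rule: less_induct)
  case less
  have H: "simple_graph H" using less.prems by (simp add: forest_def)
  show ?case
  proof (cases "verts H = {}")
    case True
    then show ?thesis using law_empty[OF H] induced_verts[OF H] by auto
  next
    case False
    then obtain v u where v: "v \<in> verts H" and leaf: "\<And>w. {w, v} \<in> edges H \<Longrightarrow> w = u"
      using forest_leaf[OF less.prems] by metis
    let ?U = "verts H - {v}"
    have "card ?U < card (verts H)"
      using v H by (intro psubset_card_mono) (auto simp: simple_graph_def)
    then obtain \<rho> where "law (induced H ?U) \<rho>"
      using less.hyps[of "induced H ?U"] forest_induced[OF less.prems] by auto
    then obtain \<nu> where "law (induced H (insert v ?U)) \<nu>"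
      using law_extend[OF H _ _ _ leaf, of ?U v] v by blast
    then show ?thesis using v induced_verts[OF H] by (auto simp: insert_absorb)
  qed
qed

text \<open>Growing \<open>U\<close> to the whole tree by \<open>law_extend\<close> never changes
  the marginal on \<open>U\<close>, and the end result is \<open>\<rho>\<close> by
  \<open>law_unique\<close>. Connectedness of \<open>U\<close> provides exactly one neighbour at
  each step.\<close>

lemma law_marg_connected:
  assumes H: "tree H" and U: "U \<subseteq> verts H" "connected_graph (induced H U)" and \<rho>: "law H \<rho>"
  shows "law (induced H U) (marg U \<rho>)"
proof -
  note sg = tree_simple_graph[OF H]
  obtain \<rho>0 where \<rho>0: "law (induced H U) \<rho>0"
    using forest_law[OF forest_induced[OF _ U(1)]] H by (auto simp: tree_def)
  have "\<exists>\<nu>. law (induced H (verts H)) \<nu> \<and> marg U \<nu> = \<rho>0"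
    using H U
  proof (rule tree_induct)
    have "marg U \<rho>0 = \<rho>0"
      using \<rho>0 by (intro marg_extensional) (auto simp: law_def dest!: Hom_extensional)
    then show "\<exists>\<nu>. law (induced H U) \<nu> \<and> marg U \<nu> = \<rho>0" using \<rho>0 by blast
  next
    fix W u v
    assume W: "U \<subseteq> W" "W \<subseteq> verts H" "v \<in> verts H - W" "\<And>w. w \<in> W \<Longrightarrow> {w, v} \<in> edges H \<Longrightarrow> w = u"
      and ex: "\<exists>\<nu>. law (induced H W) \<nu> \<and> marg U \<nu> = \<rho>0"
    from ex obtain \<nu> where \<nu>: "law (induced H W) \<nu>" "marg U \<nu> = \<rho>0" by blast
    obtain \<nu>' where "law (induced H (insert v W)) \<nu>'" "marg W \<nu>' = \<nu>"
      by (rule law_extend[OF sg W(2,3) \<nu>(1) W(4)])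
    then show "\<exists>\<nu>. law (induced H (insert v W)) \<nu> \<and> marg U \<nu> = \<rho>0"
      using \<nu>(2) marg_marg[OF W(1)] by metis
  qed
  then obtain \<nu> where "law H \<nu>" "marg U \<nu> = \<rho>0" using induced_verts[OF sg] by auto
  then show ?thesis using law_unique[OF \<rho>] \<rho>0 by auto
qed

lemma law_single:
  assumes H: "simple_graph H" and v: "v \<in> verts H" and \<rho>: "law (induced H {v}) \<rho>"
  shows "map_pmf (\<lambda>f. f v) \<rho> = stat"
proof -
  have no_edges: "{e \<in> edges H. e \<subseteq> {v}} = {}"
    using H by (auto simp: simple_graph_def subset_singleton_iff)
  have inj: "inj (\<lambda>y. \<lambda>x\<in>{v}. y)" by (rule injI) (metis restrict_apply' singletonI)
  have "law (induced H {v}) (map_pmf (\<lambda>y. \<lambda>x\<in>{v}. y) stat)"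
    unfolding law_def
  proof (intro conjI ballI)
    show "set_pmf (map_pmf (\<lambda>y. \<lambda>x\<in>{v}. y) stat) \<subseteq> Hom (induced H {v}) G"
      using edge_neq[OF H, of v v] by (auto simp: Hom_def set_stat split: if_splits)
    fix f assume f: "f \<in> Hom (induced H {v}) G"
    then have "f = (\<lambda>x\<in>{v}. f v)" by (auto simp: Hom_def fun_eq_iff extensional_def)
    then have "pmf (map_pmf (\<lambda>y. \<lambda>x\<in>{v}. y) stat) f = pmf stat (f v)"
      using pmf_map_inj'[OF inj, of stat "f v"] by simp
    moreover have "f v \<in> verts G" using f by (auto simp: Hom_def)
    ultimately show "pmf (map_pmf (\<lambda>y. \<lambda>x\<in>{v}. y) stat) f = exp (ln_wt (induced H {v}) f)"
      unfolding ln_wt_def edges_induced verts_induced no_edges by (simp add: exp_lnpi)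
  qed
  then have "\<rho> = map_pmf (\<lambda>y. \<lambda>x\<in>{v}. y) stat" using law_unique \<rho> by blast
  then show ?thesis by (simp add: map_pmf_comp)
qed

end

section \<open>Markov distributions on tree decompositions\<close>

text \<open>The part of \<open>tree_decomposition\<close> that does not mention the underlying
  graph. It suffices for gluing and passes to subtrees.\<close>

definition junction_tree :: "'a set set \<Rightarrow> 'a set ugraph \<Rightarrow> bool" where
  "junction_tree F T \<longleftrightarrow> tree T \<and> verts T = F \<and>
     (\<forall>X\<in>F. \<forall>Y\<in>F. \<forall>Z\<in>F. (\<exists>p. path_between T X p Y \<and> Z \<in> set p) \<longrightarrow> X \<inter> Y \<subseteq> Z)"

lemma junction_treeD:
  assumes "junction_tree F T"
  shows "tree T" "verts T = F" "simple_graph T" "finite F"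
    and "\<And>X Y Z p. path_between T X p Y \<Longrightarrow> Z \<in> set p \<Longrightarrow> X \<inter> Y \<subseteq> Z"
proof -
  show T: "tree T" "verts T = F" using assms by (auto simp: junction_tree_def)
  show sg: "simple_graph T" using T by (simp add: tree_simple_graph)
  show "finite F" using sg T by (simp add: simple_graph_def)
  fix X Y Z p
  assume p: "path_between T X p Y" and Z: "Z \<in> set p"
  then have "set p \<subseteq> F" "X \<in> set p" "Y \<in> set p"
    using T by (auto simp: path_between_def graph_path_def)
  then show "X \<inter> Y \<subseteq> Z" using assms p Z unfolding junction_tree_def by blast
qed

lemma junction_tree_induced:
  assumes J: "junction_tree F T" and F': "F' \<subseteq> F" "tree (induced T F')"
  shows "junction_tree F' (induced T F')"
proof -
  have "X \<inter> Y \<subseteq> Z" if "path_between (induced T F') X p Y" "Z \<in> set p" for X Y Z p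
  proof (rule junction_treeD(5)[OF J])
    show "path_between T X p Y"
      by (rule path_between_mono[OF that(1)]) (use junction_treeD[OF J] F' in auto)
  qed (rule that)
  then have "\<forall>X\<in>F'. \<forall>Y\<in>F'. \<forall>Z\<in>F'. (\<exists>p. path_between (induced T F') X p Y \<and> Z \<in> set p) \<longrightarrow> X \<inter> Y \<subseteq> Z"
    by blast
  then show ?thesis using F'(2) unfolding junction_tree_def by simp
qed

lemma separator_subset:
  assumes "simple_graph T" "e \<in> edges T"
  obtains X where "X \<in> e" "X \<in> verts T" "\<Inter>e \<subseteq> X"
proof -
  obtain X Y where "e = {X, Y}" "X \<in> verts T" by (rule edge_pairE[OF assms])
  then show thesis by (intro that[of X]) auto
qed

text \<open>A separator is represented by its tree edge \<open>e\<close>, so equal separators of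
  different edges each keep their factor. The formula expresses conditional independence of the bags
  along the tree. If the edges come from a tree on the bags, a vanishing denominator forces a
  vanishing numerator.\<close>

definition markov :: "'a set set \<Rightarrow> 'a set set set \<Rightarrow> ('a \<Rightarrow> 'b) pmf \<Rightarrow> bool" where
  "markov F E \<mu> \<longleftrightarrow> set_pmf \<mu> \<subseteq> extensional (\<Union>F) \<and>
     (\<forall>f\<in>extensional (\<Union>F). pmf \<mu> f =
       (\<Prod>X\<in>F. pmf (marg X \<mu>) (restrict f X)) / (\<Prod>e\<in>E. pmf (marg (\<Inter>e) \<mu>) (restrict f (\<Inter>e))))"

lemma markov_single:
  assumes "simple_graph T" "set_pmf \<mu> \<subseteq> extensional X"
  shows "markov {X} (edges (induced T {X})) \<mu>"
proof -
  have no_edges: "{e \<in> edges T. e \<subseteq> {X}} = {}"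
    using assms(1) by (auto simp: simple_graph_def subset_singleton_iff)
  show ?thesis
    using assms(2) unfolding markov_def edges_induced no_edges
    by (simp add: marg_extensional extensional_restrict)
qed

text \<open>Separator marginals are marginals of bag marginals, so the factorisation leaves no
  freedom beyond the bags.\<close>

lemma markov_unique:
  assumes J: "junction_tree F T" and "markov F (edges T) \<mu>" "markov F (edges T) \<nu>"
    and eq: "\<And>X. X \<in> F \<Longrightarrow> marg X \<mu> = marg X \<nu>"
  shows "\<mu> = \<nu>"
proof (rule pmf_eqI_extensional)
  show "set_pmf \<mu> \<subseteq> extensional (\<Union>F)" "set_pmf \<nu> \<subseteq> extensional (\<Union>F)"
    using assms by (auto simp: markov_def)
  fix f :: "'a \<Rightarrow> 'b"
  assume f: "f \<in> extensional (\<Union>F)"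
  have "marg (\<Inter>e) \<mu> = marg (\<Inter>e) \<nu>" if e: "e \<in> edges T" for e
  proof -
    obtain X where X: "X \<in> e" "X \<in> verts T" "\<Inter>e \<subseteq> X"
      by (rule separator_subset[OF junction_treeD(3)[OF J] e])
    have "marg (\<Inter>e) \<mu> = marg (\<Inter>e) (marg X \<mu>)" "marg (\<Inter>e) \<nu> = marg (\<Inter>e) (marg X \<nu>)"
      using marg_marg[OF X(3)] by metis+
    then show ?thesis using eq X junction_treeD(2)[OF J] by simp
  qed
  then show "pmf \<mu> f = pmf \<nu> f"
    using assms f by (simp add: markov_def)
qed

text \<open>Bags are attached one at a time along the tree by \<open>glue_pmf\<close>. An arbitrary
  connected start \<open>A\<close> serves two ends: \<open>A = {X0}\<close> gives existence, and a
  larger \<open>A\<close> gives the marginal of a Markov distribution on a subtree.\<close>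

lemma markov_extend:
  fixes M :: "'a set \<Rightarrow> ('a \<Rightarrow> 'b) pmf"
  assumes J: "junction_tree F T" and A: "A \<subseteq> F" "connected_graph (induced T A)"
    and M: "\<And>X. X \<in> F \<Longrightarrow> set_pmf (M X) \<subseteq> extensional X"
    and compat: "\<And>X Y. {X, Y} \<in> edges T \<Longrightarrow> marg (X \<inter> Y) (M X) = marg (X \<inter> Y) (M Y)"
    and \<nu>0: "markov A (edges (induced T A)) \<nu>0" "\<And>X. X \<in> A \<Longrightarrow> marg X \<nu>0 = M X"
  obtains \<nu> where "markov F (edges T) \<nu>" "\<And>X. X \<in> F \<Longrightarrow> marg X \<nu> = M X" "marg (\<Union>A) \<nu> = \<nu>0"
proof -
  note T = junction_treeD[OF J]
  let ?P = "\<lambda>U. \<exists>\<nu>. markov U (edges (induced T U)) \<nu> \<and> (\<forall>X\<in>U. marg X \<nu> = M X) \<and> marg (\<Union>A) \<nu> = \<nu>0"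
  have "?P (verts T)"
    using T(1) _ A(2)
  proof (rule tree_induct)
    have "marg (\<Union>A) \<nu>0 = \<nu>0" using \<nu>0 by (intro marg_extensional) (auto simp: markov_def)
    then show "?P A" using \<nu>0 by blast
  next
    fix U Y Z
    assume U: "A \<subseteq> U" "U \<subseteq> verts T" "connected_graph (induced T U)"
      and Y: "Y \<in> U" and Z: "Z \<in> verts T - U" and YZ: "{Y, Z} \<in> edges T"
      and uniq: "\<And>W. W \<in> U \<Longrightarrow> {W, Z} \<in> edges T \<Longrightarrow> W = Y" and "?P U"
    then obtain \<nu> where \<nu>: "markov U (edges (induced T U)) \<nu>" "\<And>X. X \<in> U \<Longrightarrow> marg X \<nu> = M X"
      "marg (\<Union>A) \<nu> = \<nu>0" by blast
    \<comment> \<open>A path from \<open>X\<close> to \<open>Y\<close> inside \<open>U\<close>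
      continues to \<open>Z\<close>, so \<open>Y\<close> lies between \<open>X\<close> and
      \<open>Z\<close>. Hence \<open>Z\<close> meets the earlier bags only in
      \<open>Y \<inter> Z\<close>.\<close>
    have "X \<inter> Z \<subseteq> Y" if "X \<in> U" for X
    proof -
      have "\<exists>p. path_between (induced T U) X p Y"
        using U(3) \<open>X \<in> U\<close> Y by (simp add: connected_graph_def)
      then obtain p where p: "path_between (induced T U) X p Y" ..
      then have pU: "set p \<subseteq> U" "Y \<in> set p" by (auto simp: path_between_def graph_path_def)
      have "path_between T X p Y" by (rule path_between_mono[OF p]) (use U in auto)
      then have "path_between T X (p @ [Z]) Z"
        by (rule path_between_snoc) (use pU Z YZ in auto)
      then show ?thesis by (rule T(5)) (use pU in auto)
    qed
    then have sep: "\<Union>U \<inter> Z = Y \<inter> Z" using Y by blast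
    have ext: "set_pmf \<nu> \<subseteq> extensional (\<Union>U)" using \<nu> by (simp add: markov_def)
    have "marg (Y \<inter> Z) \<nu> = marg (Y \<inter> Z) (M Y)"
      using \<nu>(2)[OF Y] marg_marg[of "Y \<inter> Z" Y \<nu>] by simp
    then have eq: "marg (\<Union>U \<inter> Z) \<nu> = marg (\<Union>U \<inter> Z) (M Z)"
      using compat[OF YZ] by (simp add: sep)
    have "Z \<in> F" using Z T(2) by simp
    obtain \<kappa> where \<kappa>: "set_pmf \<kappa> \<subseteq> extensional (\<Union>U \<union> Z)" "marg (\<Union>U) \<kappa> = \<nu>" "marg Z \<kappa> = M Z"
      and pmf_\<kappa>: "\<And>h. h \<in> extensional (\<Union>U \<union> Z) \<Longrightarrow> pmf \<kappa> h = pmf \<nu> (restrict h (\<Union>U)) *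
        pmf (M Z) (restrict h Z) / pmf (marg (\<Union>U \<inter> Z) (M Z)) (restrict h (\<Union>U \<inter> Z))"
      by (rule glue_pmf[OF ext M[OF \<open>Z \<in> F\<close>] eq]) (rule that)
    \<comment> \<open>Marginals on the old bags and separators are unchanged, so the factorisation
      of \<open>\<kappa>\<close> gains exactly the factor of \<open>Z\<close> and, in the
      denominator, that of \<open>Y \<inter> Z\<close>.\<close>
    have bag: "marg X \<kappa> = marg X \<nu>" if "X \<in> U" for X
      using marg_marg[OF Union_upper[OF that], of \<kappa>] by (simp add: \<kappa>(2))
    have sepm: "marg (\<Inter>e) \<kappa> = marg (\<Inter>e) \<nu>" "\<Union>U \<inter> \<Inter>e = \<Inter>e" if e: "e \<in> edges (induced T U)" for e
    proof -
      have "simple_graph (induced T U)" by (rule simple_graph_induced[OF T(3) U(2)])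
      then obtain X where "X \<in> e" "X \<in> verts (induced T U)" "\<Inter>e \<subseteq> X" using e by (rule separator_subset)
      then have "\<Inter>e \<subseteq> \<Union>U" by auto
      then show "marg (\<Inter>e) \<kappa> = marg (\<Inter>e) \<nu>" "\<Union>U \<inter> \<Inter>e = \<Inter>e"
        using marg_marg[of "\<Inter>e" "\<Union>U" \<kappa>] by (auto simp: \<kappa>(2))
    qed
    have edges: "edges (induced T (insert Z U)) = insert {Y, Z} (edges (induced T U))"
      using edges_insert_subset[OF T(3) uniq] Y YZ by simp
    have fin: "finite U" "finite (edges (induced T U))" "{Y, Z} \<notin> edges (induced T U)"
      using U(2) T finite_edges[OF T(3)] Z by (auto intro: finite_subset)
    have "markov (insert Z U) (edges (induced T (insert Z U))) \<kappa>"
      unfolding markov_def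
    proof (intro conjI ballI)
      show "set_pmf \<kappa> \<subseteq> extensional (\<Union>(insert Z U))" using \<kappa>(1) by (simp add: Un_commute)
      fix f :: "'a \<Rightarrow> 'b"
      assume "f \<in> extensional (\<Union>(insert Z U))"
      then have f: "f \<in> extensional (\<Union>U \<union> Z)" by (simp add: Un_commute)
      have "pmf \<nu> (restrict f (\<Union>U)) = (\<Prod>X\<in>U. pmf (marg X \<nu>) (restrict (restrict f (\<Union>U)) X)) /
          (\<Prod>e\<in>edges (induced T U). pmf (marg (\<Inter>e) \<nu>) (restrict (restrict f (\<Union>U)) (\<Inter>e)))"
        using \<nu>(1) unfolding markov_def by blast
      also have "(\<Prod>X\<in>U. pmf (marg X \<nu>) (restrict (restrict f (\<Union>U)) X))
          = (\<Prod>X\<in>U. pmf (marg X \<kappa>) (restrict f X))"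
      proof (rule prod.cong[OF refl])
        fix X assume "X \<in> U"
        then have "\<Union>U \<inter> X = X" by blast
        then show "pmf (marg X \<nu>) (restrict (restrict f (\<Union>U)) X) = pmf (marg X \<kappa>) (restrict f X)"
          using bag[OF \<open>X \<in> U\<close>] by simp
      qed
      also have "(\<Prod>e\<in>edges (induced T U). pmf (marg (\<Inter>e) \<nu>) (restrict (restrict f (\<Union>U)) (\<Inter>e)))
          = (\<Prod>e\<in>edges (induced T U). pmf (marg (\<Inter>e) \<kappa>) (restrict f (\<Inter>e)))"
        by (rule prod.cong[OF refl]) (simp only: sepm restrict_restrict)
      finally have \<nu>f: "pmf \<nu> (restrict f (\<Union>U)) = (\<Prod>X\<in>U. pmf (marg X \<kappa>) (restrict f X)) /
          (\<Prod>e\<in>edges (induced T U). pmf (marg (\<Inter>e) \<kappa>) (restrict f (\<Inter>e)))" .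
      have "marg (\<Union>U \<inter> Z) (M Z) = marg (\<Inter>{Y, Z}) \<kappa>"
        using marg_marg[of "Y \<inter> Z" Z \<kappa>] \<kappa>(3) by (simp add: sep)
      then have "pmf \<kappa> f = pmf \<nu> (restrict f (\<Union>U)) * pmf (marg Z \<kappa>) (restrict f Z) /
          pmf (marg (\<Inter>{Y, Z}) \<kappa>) (restrict f (\<Inter>{Y, Z}))"
        using pmf_\<kappa>[OF f] \<kappa>(3) by (simp add: sep)
      then show "pmf \<kappa> f = (\<Prod>X\<in>insert Z U. pmf (marg X \<kappa>) (restrict f X)) /
          (\<Prod>e\<in>edges (induced T (insert Z U)). pmf (marg (\<Inter>e) \<kappa>) (restrict f (\<Inter>e)))"
        unfolding edges \<nu>f using fin Z by (simp only: prod.insert DiffD2) (simp add: mult_ac)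
    qed
    moreover have "marg (\<Union>A) \<kappa> = \<nu>0"
      using marg_marg[OF Union_mono[OF U(1)], of \<kappa>] \<nu>(3) by (simp add: \<kappa>(2))
    ultimately show "?P (insert Z U)" using \<nu>(2) bag \<kappa>(3) by (intro exI[of _ \<kappa>]) auto
  qed (use A T in auto)
  moreover have "edges (induced T (verts T)) = edges T" using induced_verts[OF T(3)] by simp
  ultimately show thesis using that T(2) by auto
qed

text \<open>No summation over deleted bags is needed: a Markov distribution built on the subtree
  from the bag marginals of \<open>\<mu>\<close> extends to the whole tree, and by
  \<open>markov_unique\<close> the extension is \<open>\<mu>\<close>.\<close>

lemma markov_marg:
  assumes J: "junction_tree F T" and \<mu>: "markov F (edges T) \<mu>" and F': "F' \<subseteq> F" "tree (induced T F')"
  shows "markov F' (edges (induced T F')) (marg (\<Union>F') \<mu>)"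
proof -
  let ?T' = "induced T F'"
  note T = junction_treeD[OF J]
  have J': "junction_tree F' ?T'" by (rule junction_tree_induced[OF J F'])
  obtain X0 where X0: "X0 \<in> F'" using F'(2) by (auto simp: tree_def connected_graph_def)
  have M: "set_pmf (marg X \<mu>) \<subseteq> extensional X" for X by (rule set_marg_extensional)
  have compat: "marg (X \<inter> Y) (marg X \<mu>) = marg (X \<inter> Y) (marg Y \<mu>)" for X Y
    by (simp add: marg_marg)
  obtain \<nu>0 where \<nu>0: "markov F' (edges ?T') \<nu>0" "\<And>X. X \<in> F' \<Longrightarrow> marg X \<nu>0 = marg X \<mu>"
  proof (rule markov_extend[OF J', of "{X0}" "\<lambda>X. marg X \<mu>" "marg X0 \<mu>"])
    show "markov {X0} (edges (induced ?T' {X0})) (marg X0 \<mu>)"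
      by (rule markov_single[OF junction_treeD(3)[OF J'] M])
  qed (use X0 M in \<open>auto simp: connected_graph_single marg_marg\<close>)
  obtain \<nu> where \<nu>: "markov F (edges T) \<nu>" "\<And>X. X \<in> F \<Longrightarrow> marg X \<nu> = marg X \<mu>" "marg (\<Union>F') \<nu> = \<nu>0"
    using markov_extend[OF J F'(1) _ M compat \<nu>0] F'(2) by (auto simp: tree_def)
  have "\<nu> = \<mu>" by (rule markov_unique[OF J \<nu>(1) \<mu> \<nu>(2)])
  then show ?thesis using \<nu>(3) \<nu>0(1) by simp
qed

section \<open>Subtrees of level 0 decompositions\<close>

lemma connected_graph_Un_edge:
  assumes "simple_graph G" "connected_graph (induced G W)" "e \<in> edges G" "e \<inter> W \<noteq> {}"
  shows "connected_graph (induced G (W \<union> e))"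
proof -
  obtain a b where ab: "e = {a, b}" by (rule edge_pairE[OF assms(1,3)])
  then obtain c d where "e = {c, d}" "c \<in> W" using assms(4) by (auto simp: insert_commute)
  moreover from this have "W \<union> e = insert d W" by auto
  ultimately show ?thesis using connected_graph_insert[OF assms(2), of c d] assms(3) by simp
qed

lemma tree_single: "simple_graph T \<Longrightarrow> x \<in> verts T \<Longrightarrow> tree (induced T {x})"
  unfolding tree_def forest_def graph_cycle_def graph_path_def
  by (auto simp: connected_graph_single simple_graph_induced subset_singleton_iff
      numeral_3_eq_3 Suc_le_length_iff)

text \<open>Adjacent nodes of \<open>T\<close> are edges of \<open>H\<close> that share a vertex, so
  growing \<open>F'\<close> node by node keeps the covered part of \<open>H\<close> connected. This
  lets \<open>law_marg_connected\<close> apply to sub-decompositions at level 0.\<close>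

lemma base_subtree_connected:
  assumes D: "strong_tree_decomposition 0 H (Base F T)" and F': "F' \<subseteq> F" "tree (induced T F')"
  shows "\<Union>F' \<subseteq> verts H" "connected_graph (induced H (\<Union>F'))"
proof -
  have H: "tree H" using D by simp
  note sg = tree_simple_graph[OF H]
  obtain e0 where e0: "e0 \<in> F'" using F'(2) by (auto simp: tree_def connected_graph_def)
  have "\<Union>F' \<subseteq> verts H \<and> connected_graph (induced H (\<Union>F'))"
  proof (cases "card (verts H) = 1")
    \<comment> \<open>A one-vertex tree has its vertex set as the only bag, not an edge.\<close>
    case True
    then obtain v where "verts H = {v}" by (auto simp: card_1_singleton_iff)
    moreover have "F' = {verts H}" using D F' e0 True by auto
    ultimately show ?thesis by (simp add: connected_graph_single)
  next
    case False
    then have F: "F = edges H" and ET: "edges T \<subseteq> edges (line_graph H)"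
      using D by (auto simp: spanning_tree_def)
    have "connected_graph (induced H (\<Union>(verts (induced T F'))))"
      using F'(2) _ connected_graph_single
    proof (rule tree_induct[where A = "{e0}"])
      have "e0 \<in> edges H" using e0 F' F by auto
      moreover obtain a b where "e0 = {a, b}" by (rule edge_pairE[OF sg \<open>e0 \<in> edges H\<close>])
      ultimately show "connected_graph (induced H (\<Union>{e0}))"
        using connected_graph_insert[OF connected_graph_single, of a a b H] by (simp add: insert_commute)
    next
      fix U u v
      assume *: "u \<in> U" "v \<in> verts (induced T F') - U" "{u, v} \<in> edges (induced T F')"
        and conn: "connected_graph (induced H (\<Union>U))"
      have "{u, v} \<in> edges (line_graph H)" using *(3) ET by auto
      then have "u \<inter> v \<noteq> {}" by (auto simp: line_graph_def doubleton_eq_iff)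
      then have "v \<inter> \<Union>U \<noteq> {}" using *(1) by blast
      moreover have "v \<in> edges H" using * F F' by auto
      ultimately have "connected_graph (induced H (\<Union>U \<union> v))"
        by (intro connected_graph_Un_edge[OF sg conn])
      then show "connected_graph (induced H (\<Union>(insert v U)))" by (simp add: Un_commute)
    qed (use e0 in auto)
    moreover have "\<Union>F' \<subseteq> verts H" using F F' sg by (auto simp: simple_graph_def)
    ultimately show ?thesis by simp
  qed
  then show "\<Union>F' \<subseteq> verts H" "connected_graph (induced H (\<Union>F'))" by auto
qed

section \<open>Distributions carried by nested decompositions\<close>

context target_graph
begin

text \<open>\<open>\<mu>\<close> is the distribution carried by a nested decomposition: the
  recursion asks each bag marginal to be carried by the decomposition of that bag. The graph is a
  separate argument because the raw data does not store it.\<close>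

primrec realizes :: "'a sdecomp \<Rightarrow> 'a ugraph \<Rightarrow> ('a \<Rightarrow> 'b) pmf \<Rightarrow> bool" where
  "realizes (Base F T) H \<mu> \<longleftrightarrow> simple_graph H \<and> law H \<mu>"
| "realizes (Step F T S) H \<mu> \<longleftrightarrow> junction_tree F T \<and> \<Union>F = verts H \<and> markov F (edges T) \<mu> \<and>
     set_pmf \<mu> \<subseteq> Hom H G \<and> (\<forall>X\<in>F. realizes (S X) (induced H X) (marg X \<mu>))"

lemma realizes_Hom: "realizes D H \<mu> \<Longrightarrow> set_pmf \<mu> \<subseteq> Hom H G"
  by (cases D) (auto simp: law_def)

lemma strong_tree_decomposition_Base:
  "strong_tree_decomposition k H (Base F T) \<longleftrightarrow> k = 0 \<and> strong_tree_decomposition 0 H (Base F T)"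
  by (cases k) auto

lemma strong_tree_decomposition_Step:
  assumes "strong_tree_decomposition k H (Step F T S)"
  obtains j where "k = Suc j" "tree_decomposition H F T"
    "\<And>X. X \<in> F \<Longrightarrow> strong_tree_decomposition j (induced H X) (S X)"
  using assms by (cases k) auto

text \<open>Level 0 is handled by \<open>law_marg_connected\<close>. Above it, a spanned subtree is
  handled by \<open>markov_marg\<close>, and a bag containing \<open>U\<close> by descending into
  its decomposition.\<close>

lemma min_subdecomp_realizes:
  assumes "min_subdecomp D U D'" "strong_tree_decomposition k H D" "simple_graph H"
    "realizes D H \<mu>" "U \<subseteq> verts H"
  shows "U \<subseteq> \<Union>(bags D') \<and> \<Union>(bags D') \<subseteq> verts H \<and>
    realizes D' (induced H (\<Union>(bags D'))) (marg (\<Union>(bags D')) \<mu>)"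
  using assms
proof (induction arbitrary: k H \<mu>)
  case (Base_span F U T F')
  then have D: "strong_tree_decomposition 0 H (Base F T)" using strong_tree_decomposition_Base by blast
  have F': "U \<subseteq> \<Union>F'" "F' \<subseteq> F" "tree (induced T F')"
    using Base_span.hyps by (auto simp: minimum_covering_subtree_def covering_subtree_def)
  note conn = base_subtree_connected[OF D F'(2,3)]
  have "law (induced H (\<Union>F')) (marg (\<Union>F') \<mu>)"
    by (rule law_marg_connected[OF _ conn]) (use D Base_span.prems in auto)
  then show ?case using F' conn Base_span.prems by (simp add: simple_graph_induced)
next
  case (Base_bag X F U T)
  then have D: "strong_tree_decomposition 0 H (Base F T)" using strong_tree_decomposition_Base by blast
  have X: "X \<in> F" "U \<subseteq> X" using Base_bag.hyps by (auto simp: bags_containing_def)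
  have "simple_graph T \<and> verts T = F"
  proof (cases "card (verts H) = 1")
    case True
    then show ?thesis using D by (simp add: simple_graph_def)
  next
    case False
    then show ?thesis using D by (simp add: spanning_tree_def tree_simple_graph line_graph_def)
  qed
  then have "tree (induced T {X})" using tree_single X by auto
  note conn = base_subtree_connected[OF D _ this]
  have "law (induced H X) (marg X \<mu>)"
    by (rule law_marg_connected) (use D conn X Base_bag.prems in auto)
  then show ?case using X conn Base_bag.prems by (simp add: simple_graph_induced)
next
  case (Step_span F U T F' S)
  have F': "U \<subseteq> \<Union>F'" "F' \<subseteq> F" "tree (induced T F')"
    using Step_span.hyps by (auto simp: minimum_covering_subtree_def covering_subtree_def)
  have \<mu>: "junction_tree F T" "\<Union>F = verts H" "markov F (edges T) \<mu>" "set_pmf \<mu> \<subseteq> Hom H G"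
    "\<And>X. X \<in> F \<Longrightarrow> realizes (S X) (induced H X) (marg X \<mu>)"
    using Step_span.prems by auto
  have sub: "\<Union>F' \<subseteq> verts H" using F' \<mu>(2) by blast
  have "realizes (S X) (induced (induced H (\<Union>F')) X) (marg X (marg (\<Union>F') \<mu>))" if "X \<in> F'" for X
  proof -
    have "X \<subseteq> \<Union>F'" using that by blast
    then show ?thesis using \<mu>(5)[of X] that F'(2) by (auto simp: marg_marg)
  qed
  moreover have "set_pmf (marg (\<Union>F') \<mu>) \<subseteq> Hom (induced H (\<Union>F')) G"
    using \<mu>(4) Hom_restrict[OF _ sub] by (auto simp: set_marg)
  ultimately show ?case
    using F'(1) sub junction_tree_induced[OF \<mu>(1) F'(2,3)] markov_marg[OF \<mu>(1,3) F'(2,3)] by simp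
next
  case (Step_bag X F U S D T)
  obtain j where j: "tree_decomposition H F T"
    "\<And>X. X \<in> F \<Longrightarrow> strong_tree_decomposition j (induced H X) (S X)"
    using strong_tree_decomposition_Step[OF Step_bag.prems(1)] by metis
  have X: "X \<in> F" "U \<subseteq> X" using Step_bag.hyps by (auto simp: bags_containing_def)
  have sub: "X \<subseteq> verts H" using j(1) X by (auto simp: tree_decomposition_def)
  have IH: "U \<subseteq> \<Union>(bags D) \<and> \<Union>(bags D) \<subseteq> verts (induced H X) \<and>
    realizes D (induced (induced H X) (\<Union>(bags D))) (marg (\<Union>(bags D)) (marg X \<mu>))"
    by (rule Step_bag.IH[OF j(2)[OF X(1)]])
      (use Step_bag.prems X sub in \<open>auto simp: simple_graph_induced\<close>)
  then have "\<Union>(bags D) \<subseteq> X" by simp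
  then show ?case using IH sub by (simp add: marg_marg)
qed

end

section \<open>Counting bags and separators\<close>

text \<open>By the path condition the bags containing \<open>s\<close> span a subtree, which has one
  more vertex than edges; its edges are those whose separator contains \<open>s\<close>.\<close>

lemma junction_tree_card:
  assumes J: "junction_tree F T" and s: "X0 \<in> F" "s \<subseteq> X0"
  shows "card {e \<in> edges T. s \<subseteq> \<Inter>e} + 1 = card {X \<in> F. s \<subseteq> X}"
proof -
  note T = junction_treeD[OF J]
  let ?F = "{X \<in> F. s \<subseteq> X}"
  have "\<exists>p. path_between (induced T ?F) X p Y" if "X \<in> ?F" "Y \<in> ?F" for X Y
  proof -
    have "\<exists>p. path_between T X p Y"
      using T(1,2) that by (simp add: tree_def connected_graph_def)
    then obtain p where p: "path_between T X p Y" ..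
    have "set p \<subseteq> F" using p T(2) by (auto simp: path_between_def graph_path_def)
    moreover have "s \<subseteq> Z" if "Z \<in> set p" for Z
      using T(5)[OF p that] \<open>X \<in> ?F\<close> \<open>Y \<in> ?F\<close> by blast
    ultimately have "set p \<subseteq> ?F" by blast
    then have "path_between (induced T ?F) X p Y"
      using p unfolding path_between_def graph_path_def
      by (auto elim!: successively_mono)
    then show ?thesis ..
  qed
  then have "connected_graph (induced T ?F)"
    using s unfolding connected_graph_def verts_induced by blast
  moreover have "forest (induced T ?F)"
    by (rule forest_induced) (use T in \<open>auto simp: tree_def\<close>)
  ultimately have "tree (induced T ?F)" by (simp add: tree_def)
  then have "card (edges (induced T ?F)) + 1 = card ?F"
    using tree_card_edges[of "induced T ?F"] by simp
  moreover have "edges (induced T ?F) = {e \<in> edges T. s \<subseteq> \<Inter>e}"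
    using T(2,3) by (auto simp: simple_graph_def)
  ultimately show ?thesis by simp
qed

text \<open>Every index is counted once more among the bags than among the separators. The indices
  will be the vertices and the edges of \<open>H\<close>.\<close>

lemma junction_tree_sum:
  fixes c :: "'i \<Rightarrow> real"
  assumes J: "junction_tree F T" and K: "finite K" "\<And>i. i \<in> K \<Longrightarrow> \<exists>X\<in>F. p i \<subseteq> X"
  shows "(\<Sum>X\<in>F. \<Sum>i | i \<in> K \<and> p i \<subseteq> X. c i) =
    (\<Sum>i\<in>K. c i) + (\<Sum>e\<in>edges T. \<Sum>i | i \<in> K \<and> p i \<subseteq> \<Inter>e. c i)"
proof -
  note T = junction_treeD[OF J]
  have "(\<Sum>X\<in>F. \<Sum>i | i \<in> K \<and> p i \<subseteq> X. c i) = (\<Sum>i\<in>K. \<Sum>X | X \<in> F \<and> p i \<subseteq> X. c i)"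
    by (rule sum.swap_restrict) (use T K in auto)
  also have "\<dots> = (\<Sum>i\<in>K. c i + (\<Sum>e | e \<in> edges T \<and> p i \<subseteq> \<Inter>e. c i))"
  proof (rule sum.cong[OF refl])
    fix i assume "i \<in> K"
    then obtain X where "X \<in> F" "p i \<subseteq> X" using K by blast
    then have *: "card {X \<in> F. p i \<subseteq> X} = card {e \<in> edges T. p i \<subseteq> \<Inter>e} + 1"
      by (rule junction_tree_card[OF J, symmetric])
    show "(\<Sum>X | X \<in> F \<and> p i \<subseteq> X. c i) = c i + (\<Sum>e | e \<in> edges T \<and> p i \<subseteq> \<Inter>e. c i)"
      unfolding sum_constant * by (simp only: of_nat_add) (simp add: algebra_simps)
  qed
  also have "\<dots> = (\<Sum>i\<in>K. c i) + (\<Sum>i\<in>K. \<Sum>e | e \<in> edges T \<and> p i \<subseteq> \<Inter>e. c i)"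
    by (simp only: sum.distrib)
  also have "(\<Sum>i\<in>K. \<Sum>e | e \<in> edges T \<and> p i \<subseteq> \<Inter>e. c i)
      = (\<Sum>e\<in>edges T. \<Sum>i | i \<in> K \<and> p i \<subseteq> \<Inter>e. c i)"
    by (rule sum.swap_restrict[symmetric]) (use finite_edges[OF T(3)] K in auto)
  finally show ?thesis .
qed

text \<open>At a maximal set \<open>s\<close> whose multiplicities differ, the strict supersets
  contribute equally to both sizes, so the multiplicities of \<open>s\<close> agree after
  all.\<close>

lemma multiset_eqI_supersets:
  fixes A B :: "'a set multiset"
  assumes "\<And>s. size {#t \<in># A. s \<subseteq> t#} = size {#t \<in># B. s \<subseteq> t#}"
  shows "A = B"
proof (rule ccontr)
  assume "A \<noteq> B"
  define X where "X = {t. count A t \<noteq> count B t}"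
  have "X \<subseteq> set_mset A \<union> set_mset B" by (auto simp: X_def not_in_iff)
  then have "finite X" by (rule finite_subset) simp
  moreover have "X \<noteq> {}" using \<open>A \<noteq> B\<close> by (auto simp: X_def multiset_eq_iff)
  ultimately obtain s where s: "s \<in> X" and max: "\<And>t. t \<in> X \<Longrightarrow> s \<subseteq> t \<Longrightarrow> s = t"
    using finite_has_maximal by metis
  have split: "{#t \<in># C. s \<subseteq> t#} = {#t \<in># C. s \<subset> t#} + replicate_mset (count C s) s" for C
    by (rule multiset_eqI) auto
  have "{#t \<in># A. s \<subset> t#} = {#t \<in># B. s \<subset> t#}"
    by (rule multiset_eqI) (use max in \<open>auto simp: X_def\<close>)
  then have "count A s = count B s" using assms[of s] unfolding split by simp
  then show False using s by (simp add: X_def)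
qed

text \<open>The number of separators containing a given set only depends on the bags, so the multiset
  of separators does not depend on the tree.\<close>

lemma separator_prod_iso:
  fixes q :: "'b set \<Rightarrow> real"
  assumes J1: "junction_tree F1 T1" and J2: "junction_tree F2 T2"
    and \<phi>: "bij_betw \<phi> (\<Union>F1) (\<Union>F2)" and F: "bij_betw (\<lambda>X. \<phi> ` X) F1 F2"
  shows "(\<Prod>e\<in>edges T1. q (\<phi> ` \<Inter>e)) = (\<Prod>e\<in>edges T2. q (\<Inter>e))"
proof -
  note T1 = junction_treeD[OF J1] and T2 = junction_treeD[OF J2]
  note fin = finite_edges[OF T1(3)] finite_edges[OF T2(3)]
  let ?A = "image_mset (\<lambda>e. \<phi> ` \<Inter>e) (mset_set (edges T1))" and ?B = "image_mset Inter (mset_set (edges T2))"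
  have sep1: "\<exists>X\<in>F1. \<Inter>e \<subseteq> X" if "e \<in> edges T1" for e
    using separator_subset[OF T1(3) that] T1(2) by metis
  have sep2: "\<exists>X\<in>F2. \<Inter>e \<subseteq> X" if "e \<in> edges T2" for e
    using separator_subset[OF T2(3) that] T2(2) by metis
  have card: "card {e \<in> edges T1. s \<subseteq> \<phi> ` \<Inter>e} = card {e \<in> edges T2. s \<subseteq> \<Inter>e}" for s
  proof (cases "\<exists>Y\<in>F2. s \<subseteq> Y")
    case True
    then obtain Y where Y: "Y \<in> F2" "s \<subseteq> Y" by blast
    then obtain X where X: "X \<in> F1" "Y = \<phi> ` X" using F by (auto simp: bij_betw_def)
    \<comment> \<open>The preimage of \<open>s\<close> turns containment of \<open>s\<close> in
      images under \<open>\<phi>\<close> into containment in sets on the side of \<open>F1\<close>,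
      where \<open>junction_tree_card\<close> applies.\<close>
    define s0 where "s0 = {x \<in> \<Union>F1. \<phi> x \<in> s}"
    have s: "s \<subseteq> \<phi> ` (\<Union>F1)" using X Y by blast
    have iff: "s \<subseteq> \<phi> ` t \<longleftrightarrow> s0 \<subseteq> t" if "t \<subseteq> \<Union>F1" for t
    proof
      assume "s \<subseteq> \<phi> ` t"
      then show "s0 \<subseteq> t"
        using that \<phi> unfolding s0_def bij_betw_def inj_on_def by blast
    next
      assume "s0 \<subseteq> t"
      then show "s \<subseteq> \<phi> ` t" using s unfolding s0_def by blast
    qed
    have "{e \<in> edges T1. s \<subseteq> \<phi> ` \<Inter>e} = {e \<in> edges T1. s0 \<subseteq> \<Inter>e}"
    proof -
      have "s \<subseteq> \<phi> ` \<Inter>e \<longleftrightarrow> s0 \<subseteq> \<Inter>e" if "e \<in> edges T1" for e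
        by (rule iff) (use sep1[OF that] in blast)
      then show ?thesis by blast
    qed
    moreover have "s0 \<subseteq> X" using iff[of X] X Y by blast
    ultimately have "card {e \<in> edges T1. s \<subseteq> \<phi> ` \<Inter>e} + 1 = card {X \<in> F1. s0 \<subseteq> X}"
      using junction_tree_card[OF J1 X(1)] by simp
    also have "{X \<in> F1. s0 \<subseteq> X} = {X \<in> F1. s \<subseteq> \<phi> ` X}" using iff by blast
    also have "card \<dots> = card ((\<lambda>X. \<phi> ` X) ` {X \<in> F1. s \<subseteq> \<phi> ` X})"
      by (rule card_image[symmetric]) (use F in \<open>auto simp: bij_betw_def intro: inj_on_subset\<close>)
    also have "(\<lambda>X. \<phi> ` X) ` {X \<in> F1. s \<subseteq> \<phi> ` X} = {Y \<in> F2. s \<subseteq> Y}"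
      using F by (auto simp: bij_betw_def)
    also have "card \<dots> = card {e \<in> edges T2. s \<subseteq> \<Inter>e} + 1"
      using junction_tree_card[OF J2 Y] by simp
    finally show ?thesis by simp
  next
    \<comment> \<open>Here \<open>junction_tree_card\<close> has no bag to start from, but
      separators lie in bags, so both counts are 0.\<close>
    case False
    have "\<not> s \<subseteq> \<phi> ` \<Inter>e" if e: "e \<in> edges T1" for e
    proof
      assume "s \<subseteq> \<phi> ` \<Inter>e"
      moreover obtain X where "X \<in> F1" "\<Inter>e \<subseteq> X" using sep1[OF e] by blast
      ultimately have "s \<subseteq> \<phi> ` X" by blast
      moreover have "\<phi> ` X \<in> F2" using F \<open>X \<in> F1\<close> by (auto simp: bij_betw_def)
      ultimately show False using False by blast
    qed
    then have "{e \<in> edges T1. s \<subseteq> \<phi> ` \<Inter>e} = {}" by blast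
    moreover have "\<not> s \<subseteq> \<Inter>e" if "e \<in> edges T2" for e
      using sep2[OF that] False by (meson order_trans)
    then have "{e \<in> edges T2. s \<subseteq> \<Inter>e} = {}" by blast
    ultimately show ?thesis by (simp only: card.empty)
  qed
  have "?A = ?B"
  proof (rule multiset_eqI_supersets)
    fix s show "size {#t \<in># ?A. s \<subseteq> t#} = size {#t \<in># ?B. s \<subseteq> t#}"
      using card[of s] fin by (simp add: filter_mset_image_mset filter_mset_mset_set)
  qed
  then have "prod_mset (image_mset q ?A) = prod_mset (image_mset q ?B)" by simp
  then show ?thesis
    unfolding prod_unfold_prod_mset image_mset.compositionality o_def by simp
qed

section \<open>Transport along isomorphisms\<close>

text \<open>Isomorphisms act contravariantly: \<open>\<phi>\<close> leads from \<open>V\<close> to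
  the other vertex set, and functions there come back to \<open>V\<close>.\<close>

definition pull :: "('a \<Rightarrow> 'c) \<Rightarrow> 'a set \<Rightarrow> ('c \<Rightarrow> 'b) \<Rightarrow> 'a \<Rightarrow> 'b" where
  "pull \<phi> V f = (\<lambda>x\<in>V. f (\<phi> x))"

lemma pull_extensional [simp]: "pull \<phi> V f \<in> extensional V"
  by (simp add: pull_def)

lemma pull_eq_iff:
  assumes "bij_betw \<phi> V W" "f \<in> extensional W" "g \<in> extensional W"
  shows "pull \<phi> V f = pull \<phi> V g \<longleftrightarrow> f = g"
proof
  assume eq: "pull \<phi> V f = pull \<phi> V g"
  show "f = g"
  proof (rule extensionalityI[OF assms(2,3)])
    fix y assume "y \<in> W"
    then obtain x where "x \<in> V" "y = \<phi> x" using assms(1) by (auto simp: bij_betw_def)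
    then show "f y = g y" using fun_cong[OF eq, of x] by (simp add: pull_def)
  qed
qed simp

lemma pull_surj:
  assumes "bij_betw \<phi> V W" "g \<in> extensional V"
  obtains f where "f \<in> extensional W" "g = pull \<phi> V f"
proof
  let ?f = "\<lambda>y\<in>W. g (inv_into V \<phi> y)"
  show "?f \<in> extensional W" by simp
  show "g = pull \<phi> V ?f"
  proof (rule extensionalityI[OF assms(2)])
    fix x assume "x \<in> V"
    then show "g x = pull \<phi> V ?f x"
      using assms(1) by (auto simp: pull_def bij_betw_def)
  qed simp
qed

lemma pmf_map_pull:
  assumes "bij_betw \<phi> V W" "set_pmf \<nu> \<subseteq> extensional W" "f \<in> extensional W"
  shows "pmf (map_pmf (pull \<phi> V) \<nu>) (pull \<phi> V f) = pmf \<nu> f"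
proof -
  have "pmf (map_pmf (pull \<phi> V) \<nu>) (pull \<phi> V f) = measure \<nu> (pull \<phi> V -` {pull \<phi> V f} \<inter> set_pmf \<nu>)"
    by (simp add: pmf_map measure_Int_set_pmf)
  also have "pull \<phi> V -` {pull \<phi> V f} \<inter> set_pmf \<nu> = {f} \<inter> set_pmf \<nu>"
    using pull_eq_iff[OF assms(1) _ assms(3)] assms(2) by auto
  finally show ?thesis by (simp add: measure_Int_set_pmf measure_pmf_single)
qed

lemma restrict_pull: "X \<subseteq> V \<Longrightarrow> restrict (pull \<phi> V f) X = pull \<phi> X (restrict f (\<phi> ` X))"
  by (auto simp: pull_def restrict_def fun_eq_iff)

lemma marg_map_pull:
  "X \<subseteq> V \<Longrightarrow> marg X (map_pmf (pull \<phi> V) \<nu>) = map_pmf (pull \<phi> X) (marg (\<phi> ` X) \<nu>)"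
  by (simp add: marg_def map_pmf_comp restrict_pull)

lemma graph_iso_edges:
  assumes "graph_iso \<phi> G H" "simple_graph G" "simple_graph H"
  shows "bij_betw (\<lambda>e. \<phi> ` e) (edges G) (edges H)"
  unfolding bij_betw_def
proof
  have \<phi>: "inj_on \<phi> (verts G)" "\<phi> ` verts G = verts H"
    and e: "\<And>u v. u \<in> verts G \<Longrightarrow> v \<in> verts G \<Longrightarrow> {u, v} \<in> edges G \<longleftrightarrow> {\<phi> u, \<phi> v} \<in> edges H"
    using assms(1) by (auto simp: graph_iso_def bij_betw_def)
  have "edges G \<subseteq> Pow (verts G)" using assms(2) by (auto simp: simple_graph_def)
  then show "inj_on (\<lambda>e. \<phi> ` e) (edges G)"
    by (rule inj_on_subset[OF inj_on_image_Pow[OF \<phi>(1)]])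
  show "(\<lambda>e. \<phi> ` e) ` edges G = edges H"
  proof (intro equalityI subsetI)
    fix d assume "d \<in> (\<lambda>e. \<phi> ` e) ` edges G"
    then obtain c where c: "c \<in> edges G" "d = \<phi> ` c" by blast
    obtain u v where uv: "c = {u, v}" "u \<in> verts G" "v \<in> verts G" by (rule edge_pairE[OF assms(2) c(1)])
    then show "d \<in> edges H" using e[of u v] c by simp
  next
    fix d assume d: "d \<in> edges H"
    obtain a b where ab: "d = {a, b}" "a \<in> verts H" "b \<in> verts H" by (rule edge_pairE[OF assms(3) d])
    then obtain u v where "a = \<phi> u" "b = \<phi> v" "u \<in> verts G" "v \<in> verts G" using \<phi>(2) by blast
    then have "d = \<phi> ` {u, v}" "{u, v} \<in> edges G" using e[of u v] d ab by auto
    then show "d \<in> (\<lambda>e. \<phi> ` e) ` edges G" by blast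
  qed
qed

lemma Hom_pull:
  assumes "graph_iso \<phi> H1 H2" "f \<in> extensional (verts H2)"
  shows "pull \<phi> (verts H1) f \<in> Hom H1 G \<longleftrightarrow> f \<in> Hom H2 G"
proof -
  have \<phi>: "\<phi> ` verts H1 = verts H2"
    and e: "\<And>u v. u \<in> verts H1 \<Longrightarrow> v \<in> verts H1 \<Longrightarrow> {u, v} \<in> edges H1 \<longleftrightarrow> {\<phi> u, \<phi> v} \<in> edges H2"
    using assms(1) by (auto simp: graph_iso_def bij_betw_def)
  have "pull \<phi> (verts H1) f \<in> verts H1 \<rightarrow>\<^sub>E verts G \<longleftrightarrow> f \<in> verts H2 \<rightarrow>\<^sub>E verts G"
    using assms(2) unfolding PiE_def Pi_def \<phi>[symmetric] by (auto simp: pull_def)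
  then show ?thesis unfolding Hom_def \<phi>[symmetric] using e by (auto simp: pull_def)
qed

section \<open>Isomorphism invariance and existence of the carried distribution\<close>

context target_graph
begin

lemma ln_wt_pull:
  assumes "graph_iso \<phi> H1 H2" "simple_graph H1" "simple_graph H2"
  shows "ln_wt H1 (pull \<phi> (verts H1) f) = ln_wt H2 f"
proof -
  have \<phi>: "bij_betw \<phi> (verts H1) (verts H2)" using assms(1) by (simp add: graph_iso_def)
  have "(\<Sum>v\<in>e. lnpi (pull \<phi> (verts H1) f v)) = (\<Sum>v\<in>\<phi> ` e. lnpi (f v))" if "e \<in> edges H1" for e
  proof -
    have e: "e \<subseteq> verts H1" using that assms(2) by (auto simp: simple_graph_def)
    then have "inj_on \<phi> e" using \<phi> by (auto simp: bij_betw_def intro: inj_on_subset)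
    then have "(\<Sum>v\<in>\<phi> ` e. lnpi (f v)) = (\<Sum>v\<in>e. lnpi (f (\<phi> v)))" by (simp add: sum.reindex)
    also have "\<dots> = (\<Sum>v\<in>e. lnpi (pull \<phi> (verts H1) f v))"
      by (rule sum.cong) (use e in \<open>auto simp: pull_def\<close>)
    finally show ?thesis by simp
  qed
  then have "(\<Sum>e\<in>edges H1. - ln (card arcs) - (\<Sum>v\<in>e. lnpi (pull \<phi> (verts H1) f v)))
      = (\<Sum>e\<in>edges H1. - ln (card arcs) - (\<Sum>v\<in>\<phi> ` e. lnpi (f v)))" by simp
  also have "\<dots> = (\<Sum>e\<in>edges H2. - ln (card arcs) - (\<Sum>v\<in>e. lnpi (f v)))"
    by (rule sum.reindex_bij_betw[OF graph_iso_edges[OF assms]])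
  finally have "(\<Sum>e\<in>edges H1. - ln (card arcs) - (\<Sum>v\<in>e. lnpi (pull \<phi> (verts H1) f v)))
      = (\<Sum>e\<in>edges H2. - ln (card arcs) - (\<Sum>v\<in>e. lnpi (f v)))" .
  moreover have "(\<Sum>v\<in>verts H1. lnpi (pull \<phi> (verts H1) f v)) = (\<Sum>v\<in>verts H2. lnpi (f v))"
    using sum.reindex_bij_betw[OF \<phi>, of "\<lambda>v. lnpi (f v)"] by (simp add: pull_def)
  ultimately show ?thesis by (simp add: ln_wt_def)
qed

text \<open>The trees \<open>T1\<close> and \<open>T2\<close> need not correspond, but the
  distribution does not see them. At level 0 it depends only on the graph. Above, it is determined
  by the bag marginals, matched by induction, and by the multiset of separators, matched by
  \<open>separator_prod_iso\<close>.\<close>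

lemma sdecomp_iso_realizes:
  fixes \<phi> :: "'a \<Rightarrow> 'c"
  assumes "sdecomp_iso \<phi> H1 D1 H2 D2" "realizes D1 H1 \<mu>1" "realizes D2 H2 \<mu>2"
  shows "\<mu>1 = map_pmf (pull \<phi> (verts H1)) \<mu>2"
  using assms
proof (induction arbitrary: \<mu>1 \<mu>2)
  case (Base H1 H2 F1 T1 F2 T2)
  have law: "law H1 \<mu>1" "law H2 \<mu>2" and sg: "simple_graph H1" "simple_graph H2"
    using Base.prems by auto
  have \<phi>: "bij_betw \<phi> (verts H1) (verts H2)" using Base.hyps by (simp add: graph_iso_def)
  have ext: "set_pmf \<mu>1 \<subseteq> extensional (verts H1)" "set_pmf \<mu>2 \<subseteq> extensional (verts H2)"
    using law by (auto simp: law_def dest!: Hom_extensional)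
  show ?case
  proof (rule pmf_eqI_extensional[OF ext(1)])
    show "set_pmf (map_pmf (pull \<phi> (verts H1)) \<mu>2) \<subseteq> extensional (verts H1)" by auto
    fix g :: "'a \<Rightarrow> 'b"
    assume "g \<in> extensional (verts H1)"
    then obtain f where f: "f \<in> extensional (verts H2)" "g = pull \<phi> (verts H1) f"
      by (rule pull_surj[OF \<phi>])
    have "pmf \<mu>1 (pull \<phi> (verts H1) f) = pmf \<mu>2 f"
    proof (cases "f \<in> Hom H2 G")
      case True
      then show ?thesis
        using law Hom_pull[OF Base.hyps f(1)] ln_wt_pull[OF Base.hyps sg] by (simp add: law_def)
    next
      case False
      then have "f \<notin> set_pmf \<mu>2" "pull \<phi> (verts H1) f \<notin> set_pmf \<mu>1"
        using law Hom_pull[OF Base.hyps f(1), of G] by (auto simp: law_def)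
      then show ?thesis by (simp add: set_pmf_iff)
    qed
    then show "pmf \<mu>1 g = pmf (map_pmf (pull \<phi> (verts H1)) \<mu>2) g"
      unfolding f(2) pmf_map_pull[OF \<phi> ext(2) f(1)] .
  qed
next
  case (Step H1 H2 F1 F2 S1 S2 T1 T2)
  have r1: "junction_tree F1 T1" "\<Union>F1 = verts H1" "markov F1 (edges T1) \<mu>1"
      "\<And>X. X \<in> F1 \<Longrightarrow> realizes (S1 X) (induced H1 X) (marg X \<mu>1)"
    and r2: "junction_tree F2 T2" "\<Union>F2 = verts H2" "markov F2 (edges T2) \<mu>2"
      "\<And>X. X \<in> F2 \<Longrightarrow> realizes (S2 X) (induced H2 X) (marg X \<mu>2)"
    using Step.prems by auto
  note T1 = junction_treeD[OF r1(1)]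
  have \<phi>: "bij_betw \<phi> (verts H1) (verts H2)" using Step.hyps by (simp add: graph_iso_def)
  have F: "bij_betw (\<lambda>X. \<phi> ` X) F1 F2" by (rule Step.hyps)
  have bijX: "bij_betw \<phi> X (\<phi> ` X)" if "X \<subseteq> verts H1" for X
    using \<phi> that by (auto simp: bij_betw_def intro: inj_on_subset)
  have bag: "marg X \<mu>1 = map_pmf (pull \<phi> X) (marg (\<phi> ` X) \<mu>2)" if X: "X \<in> F1" for X
  proof -
    have "\<phi> ` X \<in> F2" using F X by (auto simp: bij_betw_def)
    then show ?thesis
      using Step.IH X r1(4)[OF X] r2(4)[of "\<phi> ` X"] by fastforce
  qed
  have sub: "marg s \<mu>1 = map_pmf (pull \<phi> s) (marg (\<phi> ` s) \<mu>2)" if X: "X \<in> F1" and "s \<subseteq> X" for s X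
  proof -
    have "marg s \<mu>1 = marg s (marg X \<mu>1)" using marg_marg[OF \<open>s \<subseteq> X\<close>] by metis
    also have "\<dots> = map_pmf (pull \<phi> s) (marg (\<phi> ` s) (marg (\<phi> ` X) \<mu>2))"
      unfolding bag[OF X] by (rule marg_map_pull[OF \<open>s \<subseteq> X\<close>])
    also have "marg (\<phi> ` s) (marg (\<phi> ` X) \<mu>2) = marg (\<phi> ` s) \<mu>2"
      by (rule marg_marg) (use \<open>s \<subseteq> X\<close> in blast)
    finally show ?thesis .
  qed
  have ext: "set_pmf \<mu>1 \<subseteq> extensional (verts H1)" "set_pmf \<mu>2 \<subseteq> extensional (verts H2)"
    using r1(2,3) r2(2,3) by (auto simp: markov_def)
  show ?case
  proof (rule pmf_eqI_extensional[OF ext(1)])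
    show "set_pmf (map_pmf (pull \<phi> (verts H1)) \<mu>2) \<subseteq> extensional (verts H1)" by auto
    fix g :: "'a \<Rightarrow> 'b"
    assume g: "g \<in> extensional (verts H1)"
    then obtain f where f: "f \<in> extensional (verts H2)" "g = pull \<phi> (verts H1) f"
      by (rule pull_surj[OF \<phi>])
    \<comment> \<open>A function of the vertex set alone, so that both factorisations become
      products of \<open>q\<close> over corresponding bags and separators.\<close>
    define q where "q = (\<lambda>t. pmf (marg t \<mu>2) (restrict f t))"
    have q: "pmf (marg s \<mu>1) (restrict g s) = q (\<phi> ` s)" if X: "X \<in> F1" and s: "s \<subseteq> X" for s X
    proof -
      have "s \<subseteq> verts H1" using X s r1(2) by blast
      show ?thesis
        unfolding sub[OF X s] q_def f(2) restrict_pull[OF \<open>s \<subseteq> verts H1\<close>]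
        by (rule pmf_map_pull[OF bijX[OF \<open>s \<subseteq> verts H1\<close>] set_marg_extensional restrict_extensional])
    qed
    have "pmf \<mu>1 g = (\<Prod>X\<in>F1. pmf (marg X \<mu>1) (restrict g X)) /
        (\<Prod>e\<in>edges T1. pmf (marg (\<Inter>e) \<mu>1) (restrict g (\<Inter>e)))"
      using r1(2,3) g by (simp add: markov_def)
    also have "(\<Prod>X\<in>F1. pmf (marg X \<mu>1) (restrict g X)) = (\<Prod>X\<in>F1. q (\<phi> ` X))"
      by (rule prod.cong) (use q in auto)
    also have "\<dots> = (\<Prod>X\<in>F2. q X)" by (rule prod.reindex_bij_betw[OF F])
    also have "(\<Prod>e\<in>edges T1. pmf (marg (\<Inter>e) \<mu>1) (restrict g (\<Inter>e))) = (\<Prod>e\<in>edges T1. q (\<phi> ` \<Inter>e))"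
    proof (rule prod.cong[OF refl])
      fix e assume "e \<in> edges T1"
      then obtain X where "X \<in> verts T1" "\<Inter>e \<subseteq> X" by (rule separator_subset[OF T1(3)])
      then show "pmf (marg (\<Inter>e) \<mu>1) (restrict g (\<Inter>e)) = q (\<phi> ` \<Inter>e)" using q T1(2) by blast
    qed
    also have "\<dots> = (\<Prod>e\<in>edges T2. q (\<Inter>e))"
      by (rule separator_prod_iso[OF r1(1) r2(1) _ F]) (use \<phi> r1(2) r2(2) in simp)
    also have "(\<Prod>X\<in>F2. q X) / \<dots> = pmf \<mu>2 f"
      using r2(2,3) f(1) by (simp add: markov_def q_def)
    finally show "pmf \<mu>1 g = pmf (map_pmf (pull \<phi> (verts H1)) \<mu>2) g"
      unfolding f(2) pmf_map_pull[OF \<phi> ext(2) f(1)] .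
  qed
qed

text \<open>Each bag carries a distribution by induction. The isomorphisms between minimum
  sub-decompositions make adjacent bags agree on their separator, which is the compatibility that
  \<open>markov_extend\<close> asks for.\<close>

lemma realizes_exists:
  assumes "strong_tree_decomposition k H D" "simple_graph H"
  shows "\<exists>\<mu>. realizes D H \<mu>"
  using assms
proof (induction k arbitrary: H D)
  case 0
  then show ?case using forest_law[of H] by (auto simp: tree_def)
next
  case (Suc k)
  obtain F T S where D: "D = Step F T S" and TD: "tree_decomposition H F T"
    and S: "\<And>X. X \<in> F \<Longrightarrow> strong_tree_decomposition k (induced H X) (S X)"
    and iso: "\<And>X Y. {X, Y} \<in> edges T \<Longrightarrow> \<exists>D1 D2 \<phi>. min_subdecomp (S X) (X \<inter> Y) D1 \<and>
      min_subdecomp (S Y) (X \<inter> Y) D2 \<and>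
      sdecomp_iso \<phi> (induced H (\<Union>(bags D1))) D1 (induced H (\<Union>(bags D2))) D2 \<and> (\<forall>v\<in>X \<inter> Y. \<phi> v = v)"
    using Suc.prems(1) by auto
  have J: "junction_tree F T" and VH: "\<Union>F = verts H" using TD by (auto simp: tree_decomposition_def junction_tree_def)
  note T = junction_treeD[OF J]
  have sg: "simple_graph (induced H X)" if "X \<in> F" for X
    using simple_graph_induced[OF Suc.prems(2)] that VH by blast
  have "\<forall>X\<in>F. \<exists>\<mu>. realizes (S X) (induced H X) \<mu>" using Suc.IH S sg by blast
  then obtain M where M: "\<And>X. X \<in> F \<Longrightarrow> realizes (S X) (induced H X) (M X)" by metis
  have MHom: "set_pmf (M X) \<subseteq> Hom (induced H X) G" if "X \<in> F" for X
    using realizes_Hom[OF M[OF that]] .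
  then have ext: "set_pmf (M X) \<subseteq> extensional X" if "X \<in> F" for X
    using that by (fastforce dest: Hom_extensional)
  have compat: "marg (X \<inter> Y) (M X) = marg (X \<inter> Y) (M Y)" if XY: "{X, Y} \<in> edges T" for X Y
  proof -
    have F: "X \<in> F" "Y \<in> F" using edge_verts[OF T(3) XY] T(2) by auto
    from iso[OF XY] obtain D1 D2 \<phi> where
      D1: "min_subdecomp (S X) (X \<inter> Y) D1" and D2: "min_subdecomp (S Y) (X \<inter> Y) D2"
      and \<phi>: "sdecomp_iso \<phi> (induced H (\<Union>(bags D1))) D1 (induced H (\<Union>(bags D2))) D2"
      and fixed: "\<And>v. v \<in> X \<inter> Y \<Longrightarrow> \<phi> v = v" by blast
    let ?W1 = "\<Union>(bags D1)" and ?W2 = "\<Union>(bags D2)"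
    have 1: "X \<inter> Y \<subseteq> ?W1 \<and> ?W1 \<subseteq> verts (induced H X) \<and>
        realizes D1 (induced (induced H X) ?W1) (marg ?W1 (M X))"
      by (rule min_subdecomp_realizes[OF D1 S[OF F(1)] sg[OF F(1)] M[OF F(1)]]) simp
    have 2: "X \<inter> Y \<subseteq> ?W2 \<and> ?W2 \<subseteq> verts (induced H Y) \<and>
        realizes D2 (induced (induced H Y) ?W2) (marg ?W2 (M Y))"
      by (rule min_subdecomp_realizes[OF D2 S[OF F(2)] sg[OF F(2)] M[OF F(2)]]) simp
    have "?W1 \<subseteq> X" "?W2 \<subseteq> Y" using 1 2 by auto
    then have "marg ?W1 (M X) = map_pmf (pull \<phi> ?W1) (marg ?W2 (M Y))"
      using sdecomp_iso_realizes[OF \<phi>] 1 2 by simp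
    then have "marg (X \<inter> Y) (marg ?W1 (M X)) = marg (X \<inter> Y) (map_pmf (pull \<phi> ?W1) (marg ?W2 (M Y)))"
      by simp
    also have "\<dots> = map_pmf (pull \<phi> (X \<inter> Y)) (marg (\<phi> ` (X \<inter> Y)) (marg ?W2 (M Y)))"
      using 1 by (intro marg_map_pull) simp
    \<comment> \<open>Since \<open>\<phi>\<close> fixes \<open>X \<inter> Y\<close> pointwise, it
      maps the separator to itself and pulling back along it changes nothing.\<close>
    also have "\<phi> ` (X \<inter> Y) = X \<inter> Y" using fixed by (simp add: image_def)
    also have "map_pmf (pull \<phi> (X \<inter> Y)) (marg (X \<inter> Y) (marg ?W2 (M Y))) = marg (X \<inter> Y) (marg ?W2 (M Y))"
      by (rule map_pmf_idI) (use fixed in \<open>auto simp: set_marg pull_def restrict_def fun_eq_iff\<close>)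
    finally show ?thesis using 1 2 by (simp add: marg_marg)
  qed
  obtain X0 where X0: "X0 \<in> F" using T by (auto simp: tree_def connected_graph_def)
  obtain \<nu> where \<nu>: "markov F (edges T) \<nu>" "\<And>X. X \<in> F \<Longrightarrow> marg X \<nu> = M X"
  proof (rule markov_extend[OF J _ connected_graph_single ext compat])
    show "markov {X0} (edges (induced T {X0})) (M X0)" by (rule markov_single[OF T(3) ext[OF X0]])
  qed (use X0 marg_extensional[OF ext[OF X0]] in auto)
  \<comment> \<open>Every vertex and every edge of \<open>H\<close> lies in a bag, where the
    marginal of \<open>\<nu>\<close> is supported on homomorphisms.\<close>
  have "f \<in> Hom H G" if f: "f \<in> set_pmf \<nu>" for f
  proof -
    have fX: "restrict f X \<in> Hom (induced H X) G" if "X \<in> F" for X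
    proof -
      have "restrict f X \<in> set_pmf (M X)" using f by (simp add: \<nu>(2)[OF that, symmetric] set_marg)
      then show ?thesis using MHom[OF that] by blast
    qed
    have "f v \<in> verts G" if v: "v \<in> verts H" for v
    proof -
      have "v \<in> \<Union>F" using v VH by simp
      then obtain X where "X \<in> F" "v \<in> X" ..
      then show ?thesis using fX[of X] by (auto simp: Hom_def)
    qed
    moreover have "f \<in> extensional (verts H)" using \<nu>(1) VH f by (auto simp: markov_def)
    moreover have "{f u, f v} \<in> edges G" if uv: "{u, v} \<in> edges H" for u v
    proof -
      obtain X where "X \<in> F" "{u, v} \<subseteq> X" using TD uv by (auto simp: tree_decomposition_def)
      then show ?thesis using fX[of X] uv by (auto simp: Hom_def)
    qed
    ultimately show ?thesis by (auto simp: Hom_def PiE_def)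
  qed
  then have "realizes D H \<nu>" using J VH \<nu> M by (auto simp: D)
  then show ?case ..
qed

end

section \<open>Entropy\<close>

lemma expectation_cong:
  fixes \<phi> \<psi> :: "'c \<Rightarrow> real"
  shows "(\<And>x. x \<in> set_pmf \<mu> \<Longrightarrow> \<phi> x = \<psi> x) \<Longrightarrow>
    measure_pmf.expectation \<mu> \<phi> = measure_pmf.expectation \<mu> \<psi>"
  by (rule integral_cong_AE) (auto simp: AE_measure_pmf_iff)

text \<open>The weights need not be normalised: with W their sum, ln t \<le> t - 1 is applied to t =
  \<open>w x / (pmf \<mu> x * W)\<close> and averaged. Three weights occur: that of a graph with a
  \<open>law\<close>, the constant 1, and a product over the isolated vertices of
  \<open>H\<close>.\<close>

lemma gibbs_inequality:
  assumes A: "finite A" "set_pmf \<mu> \<subseteq> A"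
    and w: "\<And>x. x \<in> A \<Longrightarrow> 0 \<le> w x" "\<And>x. x \<in> set_pmf \<mu> \<Longrightarrow> 0 < w x"
  shows "measure_pmf.expectation \<mu> (\<lambda>x. ln (w x)) - measure_pmf.expectation \<mu> (\<lambda>x. ln (pmf \<mu> x))
    \<le> ln (\<Sum>x\<in>A. w x)"
proof -
  let ?S = "set_pmf \<mu>"
  have fin: "finite ?S" using A by (rule finite_subset[rotated])
  define W where "W = (\<Sum>x\<in>A. w x)"
  have SW: "(\<Sum>x\<in>?S. w x) \<le> W" unfolding W_def by (rule sum_mono2) (use A w in auto)
  have "0 < (\<Sum>x\<in>?S. w x)" by (rule sum_pos) (use fin w set_pmf_not_empty in auto)
  then have W: "0 < W" using SW by simp
  have int: "measure_pmf.expectation \<mu> g = (\<Sum>x\<in>?S. g x * pmf \<mu> x)" for g :: "_ \<Rightarrow> real"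
    by (rule integral_measure_pmf_real[OF fin]) auto
  have one: "(\<Sum>x\<in>?S. pmf \<mu> x) = 1" by (rule sum_pmf_eq_1[OF fin]) simp
  have "(ln (w x) - ln (pmf \<mu> x)) * pmf \<mu> x \<le> (ln W - 1) * pmf \<mu> x + w x / W" if x: "x \<in> ?S" for x
  proof -
    have p: "0 < pmf \<mu> x" by (rule pmf_positive[OF x])
    have "ln (w x / (pmf \<mu> x * W)) \<le> w x / (pmf \<mu> x * W) - 1"
      by (rule ln_le_minus_one) (use p W w(2)[OF x] in simp)
    then have "ln (w x) - ln (pmf \<mu> x) \<le> ln W - 1 + w x / (pmf \<mu> x * W)"
      using p W w(2)[OF x] by (simp add: ln_div ln_mult)
    then have "(ln (w x) - ln (pmf \<mu> x)) * pmf \<mu> x \<le> (ln W - 1 + w x / (pmf \<mu> x * W)) * pmf \<mu> x"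
      using p by (intro mult_right_mono) auto
    also have "\<dots> = (ln W - 1) * pmf \<mu> x + w x / W" using p by (simp add: field_simps)
    finally show ?thesis .
  qed
  then have "(\<Sum>x\<in>?S. (ln (w x) - ln (pmf \<mu> x)) * pmf \<mu> x) \<le> (\<Sum>x\<in>?S. (ln W - 1) * pmf \<mu> x + w x / W)"
    by (rule sum_mono)
  also have "\<dots> = (ln W - 1) + (\<Sum>x\<in>?S. w x) / W"
    by (simp add: sum.distrib sum_distrib_left[symmetric] one sum_divide_distrib[symmetric])
  also have "\<dots> \<le> ln W" using SW W by simp
  finally show ?thesis
    unfolding int W_def by (simp add: left_diff_distrib sum_subtractf)
qed

section \<open>Isolated vertices of the source graph\<close>

lemma card_covered_vertices:
  assumes "simple_graph H"
  shows "card (\<Union>(edges H)) \<le> 2 * card (edges H)"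
proof -
  have "card (\<Union>(edges H)) \<le> sum card (edges H)"
    by (rule card_Union_le_sum_card)
  also have "\<dots> = (\<Sum>e\<in>edges H. 2)"
    by (rule sum.cong) (use assms in \<open>auto simp: simple_graph_def\<close>)
  finally show ?thesis by simp
qed

text \<open>Vertices outside \<open>A\<close> lie in no edge, so their images are free and the
  weighted sum factorises. The choices for \<open>q\<close> will be \<open>pmf stat\<close>, of
  total 1, and the constant 1, of total |V(G)|.\<close>

lemma Hom_split_isolated:
  assumes H: "simple_graph H" and G: "simple_graph G"
    and A: "A \<subseteq> verts H" "\<And>e. e \<in> edges H \<Longrightarrow> e \<subseteq> A"
  shows "(\<Sum>f\<in>Hom H G. \<Prod>v\<in>verts H - A. q (f v)) =
    real (card (Hom (induced H A) G)) * (\<Sum>x\<in>verts G. q x) ^ card (verts H - A)"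
proof -
  let ?I = "verts H - A"
  have fin: "finite ?I" "finite (verts G)" using H G by (auto simp: simple_graph_def)
  have V: "A \<union> ?I = verts H" using A by blast
  have AI: "A \<inter> ?I = {}" by blast
  have merge: "merge A ?I g h \<in> Hom H G" "restrict (merge A ?I g h) A = g" "restrict (merge A ?I g h) ?I = h"
    if g: "g \<in> Hom (induced H A) G" and h: "h \<in> ?I \<rightarrow>\<^sub>E verts G" for g h
  proof -
    have ext: "g \<in> extensional A" "h \<in> extensional ?I"
      using g h by (auto simp: Hom_def PiE_def)
    have "merge A ?I g h = merge A ?I g h \<longleftrightarrow>
        g = restrict (merge A ?I g h) A \<and> h = restrict (merge A ?I g h) ?I"
      by (rule merge_eq_iff[OF ext]) (auto simp: merge_def AI)
    then show "restrict (merge A ?I g h) A = g" "restrict (merge A ?I g h) ?I = h" by simp_all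
    have "merge A ?I g h \<in> verts H \<rightarrow>\<^sub>E verts G"
      using g h V unfolding merge_def by (auto simp: Hom_def PiE_iff)
    moreover have "{merge A ?I g h u, merge A ?I g h v} \<in> edges G" if uv: "{u, v} \<in> edges H" for u v
    proof -
      have "u \<in> A" "v \<in> A" using A(2)[OF uv] by auto
      then show ?thesis using g uv by (auto simp: Hom_def merge_def)
    qed
    ultimately show "merge A ?I g h \<in> Hom H G" by (auto simp: Hom_def)
  qed
  have "(\<Sum>f\<in>Hom H G. \<Prod>v\<in>?I. q (f v)) =
      (\<Sum>(g, h)\<in>Hom (induced H A) G \<times> (?I \<rightarrow>\<^sub>E verts G). \<Prod>v\<in>?I. q (h v))"
  proof (rule sum.reindex_bij_witness[where
        i = "\<lambda>(g, h). merge A ?I g h" and j = "\<lambda>f. (restrict f A, restrict f ?I)"])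
    fix f assume f: "f \<in> Hom H G"
    then have ext: "f \<in> extensional (A \<union> ?I)" using V Hom_extensional by metis
    show "(case (restrict f A, restrict f ?I) of (g, h) \<Rightarrow> merge A ?I g h) = f"
      using ext by (auto simp: merge_def fun_eq_iff extensional_def)
    show "(restrict f A, restrict f ?I) \<in> Hom (induced H A) G \<times> (?I \<rightarrow>\<^sub>E verts G)"
      using f Hom_restrict[OF f A(1)] by (auto simp: Hom_def)
    show "(case (restrict f A, restrict f ?I) of (g, h) \<Rightarrow> \<Prod>v\<in>?I. q (h v)) = (\<Prod>v\<in>?I. q (f v))"
      by simp
  qed (auto simp: merge)
  also have "\<dots> = real (card (Hom (induced H A) G)) * (\<Sum>h\<in>?I \<rightarrow>\<^sub>E verts G. \<Prod>v\<in>?I. q (h v))"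
    by (simp add: sum.cartesian_product[symmetric])
  also have "(\<Sum>h\<in>?I \<rightarrow>\<^sub>E verts G. \<Prod>v\<in>?I. q (h v)) = (\<Sum>x\<in>verts G. q x) ^ card ?I"
    using prod_sum_PiE[OF fin(1), of "\<lambda>_. verts G" "\<lambda>_. q"] fin(2) by simp
  finally show ?thesis .
qed

section \<open>Relative entropy of the carried distribution\<close>

context target_graph
begin

lemma finite_support: "simple_graph H \<Longrightarrow> set_pmf \<mu> \<subseteq> Hom H G \<Longrightarrow> finite (set_pmf \<mu>)"
  using finite_Hom[OF _ simple] finite_subset by blast

text \<open>If \<open>H\<close> has a law, the total weight is 1 and the relative entropy with
  respect to it is nonnegative. This is the direction wanted for separators, which enter with a
  minus sign.\<close>

lemma law_gibbs:
  assumes H: "simple_graph H" and \<rho>: "law H \<rho>" and \<mu>: "set_pmf \<mu> \<subseteq> Hom H G"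
  shows "measure_pmf.expectation \<mu> (ln_wt H) \<le> measure_pmf.expectation \<mu> (\<lambda>f. ln (pmf \<mu> f))"
proof -
  have "(\<Sum>f\<in>Hom H G. exp (ln_wt H f)) = (\<Sum>f\<in>Hom H G. pmf \<rho> f)"
    using \<rho> by (simp add: law_def)
  also have "\<dots> = 1"
    by (rule sum_pmf_eq_1) (use \<rho> finite_Hom[OF H simple] in \<open>auto simp: law_def\<close>)
  finally show ?thesis
    using gibbs_inequality[OF finite_Hom[OF H simple] \<mu>, of "\<lambda>f. exp (ln_wt H f)"] by simp
qed

text \<open>Apply \<open>junction_tree_sum\<close> to the vertices and to the edges of
  \<open>H\<close>, each of which lies in some bag.\<close>

lemma ln_wt_decomposition:
  assumes H: "simple_graph H" and TD: "tree_decomposition H F T"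
  shows "(\<Sum>X\<in>F. ln_wt (induced H X) f) = ln_wt H f + (\<Sum>e\<in>edges T. ln_wt (induced H (\<Inter>e)) f)"
proof -
  have J: "junction_tree F T" and VH: "\<Union>F = verts H" and E: "\<And>e. e \<in> edges H \<Longrightarrow> \<exists>X\<in>F. e \<subseteq> X"
    using TD by (auto simp: tree_decomposition_def junction_tree_def)
  note T = junction_treeD[OF J]
  have wt: "ln_wt (induced H X) f = (\<Sum>v | v \<in> verts H \<and> {v} \<subseteq> X. lnpi (f v)) +
      (\<Sum>e | e \<in> edges H \<and> e \<subseteq> X. - ln (card arcs) - (\<Sum>v\<in>e. lnpi (f v)))" if "X \<subseteq> verts H" for X
  proof -
    have "{v. v \<in> verts H \<and> {v} \<subseteq> X} = X" using that by auto
    then show ?thesis by (simp add: ln_wt_def)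
  qed
  have sub: "\<Inter>e \<subseteq> verts H" if e: "e \<in> edges T" for e
  proof -
    obtain X where "X \<in> verts T" "\<Inter>e \<subseteq> X" by (rule separator_subset[OF T(3) e])
    then show ?thesis using VH T(2) by blast
  qed
  have "(\<Sum>X\<in>F. ln_wt (induced H X) f) = (\<Sum>X\<in>F. (\<Sum>v | v \<in> verts H \<and> {v} \<subseteq> X. lnpi (f v)) +
      (\<Sum>e | e \<in> edges H \<and> e \<subseteq> X. - ln (card arcs) - (\<Sum>v\<in>e. lnpi (f v))))"
    by (rule sum.cong[OF refl wt]) (use VH in blast)
  also have "\<dots> = (\<Sum>v\<in>verts H. lnpi (f v)) + (\<Sum>s\<in>edges T. \<Sum>v | v \<in> verts H \<and> {v} \<subseteq> \<Inter>s. lnpi (f v)) +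
      ((\<Sum>e\<in>edges H. - ln (card arcs) - (\<Sum>v\<in>e. lnpi (f v))) +
       (\<Sum>s\<in>edges T. \<Sum>e | e \<in> edges H \<and> e \<subseteq> \<Inter>s. - ln (card arcs) - (\<Sum>v\<in>e. lnpi (f v))))"
  proof (subst sum.distrib, rule arg_cong2[where f = "(+)"])
    show "(\<Sum>X\<in>F. \<Sum>v | v \<in> verts H \<and> {v} \<subseteq> X. lnpi (f v)) = (\<Sum>v\<in>verts H. lnpi (f v)) +
        (\<Sum>s\<in>edges T. \<Sum>v | v \<in> verts H \<and> {v} \<subseteq> \<Inter>s. lnpi (f v))"
      by (rule junction_tree_sum[OF J]) (use H VH in \<open>auto simp: simple_graph_def\<close>)
    show "(\<Sum>X\<in>F. \<Sum>e | e \<in> edges H \<and> e \<subseteq> X. - ln (card arcs) - (\<Sum>v\<in>e. lnpi (f v))) =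
        (\<Sum>e\<in>edges H. - ln (card arcs) - (\<Sum>v\<in>e. lnpi (f v))) +
        (\<Sum>s\<in>edges T. \<Sum>e | e \<in> edges H \<and> e \<subseteq> \<Inter>s. - ln (card arcs) - (\<Sum>v\<in>e. lnpi (f v)))"
      by (rule junction_tree_sum[OF J finite_edges[OF H] E])
  qed
  also have "\<dots> = ln_wt H f + (\<Sum>s\<in>edges T. (\<Sum>v | v \<in> verts H \<and> {v} \<subseteq> \<Inter>s. lnpi (f v)) +
      (\<Sum>e | e \<in> edges H \<and> e \<subseteq> \<Inter>s. - ln (card arcs) - (\<Sum>v\<in>e. lnpi (f v))))"
    by (simp only: ln_wt_def sum.distrib add_ac)
  also have "(\<Sum>s\<in>edges T. (\<Sum>v | v \<in> verts H \<and> {v} \<subseteq> \<Inter>s. lnpi (f v)) +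
      (\<Sum>e | e \<in> edges H \<and> e \<subseteq> \<Inter>s. - ln (card arcs) - (\<Sum>v\<in>e. lnpi (f v))))
      = (\<Sum>s\<in>edges T. ln_wt (induced H (\<Inter>s)) f)"
    by (rule sum.cong[OF refl wt[OF sub, symmetric]])
  finally show ?thesis .
qed

text \<open>The logarithm of the Markov factorisation is a sum over bags minus a sum over
  separators. Bags are bounded by induction, separators, being forests, in the opposite direction by
  \<open>law_gibbs\<close>. At level 0 equality holds.\<close>

lemma entropy_bound:
  assumes "strong_tree_decomposition k H D" "simple_graph H" "realizes D H \<mu>"
  shows "measure_pmf.expectation \<mu> (\<lambda>f. ln (pmf \<mu> f)) \<le> measure_pmf.expectation \<mu> (ln_wt H)"
  using assms
proof (induction k arbitrary: H D \<mu>)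
  case 0
  then have "law H \<mu>" by auto
  then have "measure_pmf.expectation \<mu> (\<lambda>f. ln (pmf \<mu> f)) = measure_pmf.expectation \<mu> (ln_wt H)"
    by (intro expectation_cong) (auto simp: law_def)
  then show ?case by simp
next
  case (Suc k)
  obtain F T S where D: "D = Step F T S" and TD: "tree_decomposition H F T"
    and S: "\<And>X. X \<in> F \<Longrightarrow> strong_tree_decomposition k (induced H X) (S X)"
    and forest: "\<And>X Y. {X, Y} \<in> edges T \<Longrightarrow> forest (induced H (X \<inter> Y))"
    using Suc.prems(1) by auto
  have J: "junction_tree F T" and VH: "\<Union>F = verts H" and mk: "markov F (edges T) \<mu>"
    and \<mu>: "set_pmf \<mu> \<subseteq> Hom H G"
    and bags: "\<And>X. X \<in> F \<Longrightarrow> realizes (S X) (induced H X) (marg X \<mu>)"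
    using Suc.prems(3) by (auto simp: D)
  note T = junction_treeD[OF J]
  have int: "integrable \<mu> g" for g :: "_ \<Rightarrow> real"
    by (rule integrable_measure_pmf_finite[OF finite_support[OF Suc.prems(2) \<mu>]])
  let ?E = "measure_pmf.expectation \<mu>"
  let ?l = "\<lambda>X f. ln (pmf (marg X \<mu>) (restrict f X))"
  have subX: "X \<subseteq> verts H" if "X \<in> F" for X using VH that by blast
  have finE: "finite (edges T)" by (rule finite_edges[OF T(3)])
  have "?E (\<lambda>f. ln (pmf \<mu> f)) = ?E (\<lambda>f. (\<Sum>X\<in>F. ?l X f) - (\<Sum>e\<in>edges T. ?l (\<Inter>e) f))"
  proof (rule expectation_cong)
    fix f assume f: "f \<in> set_pmf \<mu>"
    have "f \<in> extensional (\<Union>F)" using f mk by (auto simp: markov_def)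
    then have "pmf \<mu> f = (\<Prod>X\<in>F. pmf (marg X \<mu>) (restrict f X)) /
        (\<Prod>e\<in>edges T. pmf (marg (\<Inter>e) \<mu>) (restrict f (\<Inter>e)))"
      using mk by (simp add: markov_def)
    moreover have "pmf (marg U \<mu>) (restrict f U) \<noteq> 0" for U
      using pmf_marg_pos[OF f, of U] by simp
    ultimately show "ln (pmf \<mu> f) = (\<Sum>X\<in>F. ?l X f) - (\<Sum>e\<in>edges T. ?l (\<Inter>e) f)"
      using T(4) finE by (simp add: ln_div ln_prod)
  qed
  also have "\<dots> = (\<Sum>X\<in>F. ?E (?l X)) - (\<Sum>e\<in>edges T. ?E (?l (\<Inter>e)))"
    by (subst Bochner_Integration.integral_diff) (simp_all add: int Bochner_Integration.integral_sum)
  also have "\<dots> \<le> (\<Sum>X\<in>F. ?E (ln_wt (induced H X))) - (\<Sum>e\<in>edges T. ?E (ln_wt (induced H (\<Inter>e))))"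
  proof (rule diff_mono; rule sum_mono)
    fix X assume X: "X \<in> F"
    note sg = simple_graph_induced[OF Suc.prems(2) subX[OF X]]
    have "?E (?l X) = measure_pmf.expectation (marg X \<mu>) (\<lambda>f. ln (pmf (marg X \<mu>) f))"
      by (simp add: expectation_marg)
    also have "\<dots> \<le> measure_pmf.expectation (marg X \<mu>) (ln_wt (induced H X))"
      by (rule Suc.IH[OF S[OF X] sg bags[OF X]])
    also have "\<dots> = ?E (ln_wt (induced H X))"
      using ln_wt_restrict[OF Suc.prems(2) subX[OF X]] by (simp add: expectation_marg)
    finally show "?E (?l X) \<le> ?E (ln_wt (induced H X))" .
  next
    fix e assume e: "e \<in> edges T"
    obtain X where X: "X \<in> verts T" "\<Inter>e \<subseteq> X" by (rule separator_subset[OF T(3) e])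
    then have sub: "\<Inter>e \<subseteq> verts H" using VH T(2) by blast
    note sg = simple_graph_induced[OF Suc.prems(2) sub]
    obtain Y Z where YZ: "e = {Y, Z}" by (rule edge_pairE[OF T(3) e])
    then have "forest (induced H (\<Inter>e))" using forest[of Y Z] e by simp
    then obtain \<rho> where \<rho>: "law (induced H (\<Inter>e)) \<rho>" using forest_law by blast
    have "?E (ln_wt (induced H (\<Inter>e))) = measure_pmf.expectation (marg (\<Inter>e) \<mu>) (ln_wt (induced H (\<Inter>e)))"
      using ln_wt_restrict[OF Suc.prems(2) sub] by (simp add: expectation_marg)
    also have "\<dots> \<le> measure_pmf.expectation (marg (\<Inter>e) \<mu>) (\<lambda>f. ln (pmf (marg (\<Inter>e) \<mu>) f))"
      by (rule law_gibbs[OF sg \<rho>]) (use \<mu> Hom_restrict[OF _ sub] in \<open>auto simp: set_marg\<close>)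
    also have "\<dots> = ?E (?l (\<Inter>e))" by (simp add: expectation_marg)
    finally show "?E (ln_wt (induced H (\<Inter>e))) \<le> ?E (?l (\<Inter>e))" .
  qed
  also have "\<dots> = ?E (\<lambda>f. (\<Sum>X\<in>F. ln_wt (induced H X) f) - (\<Sum>e\<in>edges T. ln_wt (induced H (\<Inter>e)) f))"
    by (subst Bochner_Integration.integral_diff) (simp_all add: int Bochner_Integration.integral_sum)
  also have "\<dots> = ?E (ln_wt H)"
    by (simp add: ln_wt_decomposition[OF Suc.prems(2) TD])
  finally show ?case .
qed

text \<open>Descending through bags that contain \<open>v\<close> ends at a tree, where the
  one-vertex subtree has the law \<open>stat\<close>.\<close>

lemma vertex_marginal:
  assumes "strong_tree_decomposition k H D" "simple_graph H" "realizes D H \<mu>" "v \<in> verts H"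
  shows "map_pmf (\<lambda>f. f v) \<mu> = stat"
  using assms
proof (induction k arbitrary: H D \<mu>)
  case 0
  then have H: "tree H" and law: "law H \<mu>" by auto
  have "law (induced H {v}) (marg {v} \<mu>)"
    by (rule law_marg_connected[OF H _ connected_graph_single law]) (use 0 in auto)
  then have "map_pmf (\<lambda>f. f v) (marg {v} \<mu>) = stat"
    by (rule law_single[OF 0(2,4)])
  then show ?case by (simp add: marg_def map_pmf_comp)
next
  case (Suc k)
  obtain F T S where D: "D = Step F T S"
    and S: "\<And>X. X \<in> F \<Longrightarrow> strong_tree_decomposition k (induced H X) (S X)"
    using Suc.prems(1) by auto
  have VH: "\<Union>F = verts H"
    and bags: "\<And>X. X \<in> F \<Longrightarrow> realizes (S X) (induced H X) (marg X \<mu>)"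
    using Suc.prems(3) by (auto simp: D)
  obtain X where X: "X \<in> F" "v \<in> X" using Suc.prems(4) unfolding VH[symmetric] ..
  then have "map_pmf (\<lambda>f. f v) (marg X \<mu>) = stat"
    using VH by (intro Suc.IH[OF S[OF X(1)] _ bags[OF X(1)]] simple_graph_induced[OF Suc.prems(2)]) auto
  then show ?case using X(2) by (simp add: marg_def map_pmf_comp)
qed

section \<open>The bound for targets without isolated vertices\<close>

lemma card_arcs: "card arcs = 2 * card (edges G)"
proof -
  let ?g = "\<lambda>(x, y). {x, y}"
  have "card {p \<in> arcs. ?g p = e} = 2" if e: "e \<in> edges G" for e
  proof -
    obtain u v where uv: "e = {u, v}" "u \<noteq> v" by (rule edge_pairE[OF simple e])
    have e': "{u, v} \<in> edges G" "{v, u} \<in> edges G" using e by (simp_all add: uv(1) insert_commute)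
    have "p \<in> arcs \<and> ?g p = e \<longleftrightarrow> p = (u, v) \<or> p = (v, u)" for p
      using e' unfolding uv(1) arcs_def
      by (cases p) (simp only: doubleton_eq_iff split_conv mem_Collect_eq prod.inject, metis)
    then have "{p \<in> arcs. ?g p = e} = {(u, v), (v, u)}"
      unfolding set_eq_iff mem_Collect_eq insert_iff empty_iff by simp
    then show ?thesis using uv(2) by simp
  qed
  then have "(\<Sum>e\<in>edges G. \<Sum>p | p \<in> arcs \<and> ?g p = e. (1::nat)) = 2 * card (edges G)" by simp
  moreover have "(\<Sum>e\<in>edges G. \<Sum>p | p \<in> arcs \<and> ?g p = e. (1::nat)) = (\<Sum>p\<in>arcs. 1)"
    by (rule sum.group[OF finite_arcs finite_edges[OF simple]]) (auto simp: arcs_def)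
  ultimately show ?thesis by simp
qed

text \<open>Gibbs with constant weight 1: the stationary distribution has at most the entropy of the
  uniform one.\<close>

lemma expectation_lnpi: "- measure_pmf.expectation stat lnpi \<le> ln (card (verts G))"
  using gibbs_inequality[of "verts G" stat "\<lambda>_. 1"] simple
  by (simp add: set_stat simple_graph_def lnpi_def[abs_def])

text \<open>Comparing \<open>\<mu>\<close> with the product of \<pi>(f v) over the isolated vertices
  of \<open>H\<close> gives total weight |Hom(H[A], G)| and removes these vertices from the entropy
  bound. The coefficient of \<open>c\<close> becomes 2|E(H)| - |A| \<ge> 0, so that \<open>c\<close>
  \<ge> - ln |V(G)| can be inserted.\<close>

lemma Hom_lower_bound:
  assumes D: "strong_tree_decomposition k H D" and H: "simple_graph H"
  defines "A \<equiv> \<Union>(edges H)"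
  shows "(2 * real (card (edges G))) ^ card (edges H) \<le>
    real (card (Hom (induced H A) G)) * real (card (verts G)) ^ (2 * card (edges H) - card A)"
proof -
  obtain \<mu> where r: "realizes D H \<mu>" using realizes_exists[OF D H] ..
  note \<mu> = realizes_Hom[OF r]
  let ?E = "measure_pmf.expectation \<mu>" and ?I = "verts H - A"
  define c where "c = measure_pmf.expectation stat lnpi"
  have AV: "A \<subseteq> verts H" using H by (auto simp: A_def simple_graph_def)
  have finV: "finite (verts H)" using H by (simp add: simple_graph_def)
  have int: "integrable \<mu> g" for g :: "_ \<Rightarrow> real"
    by (rule integrable_measure_pmf_finite[OF finite_support[OF H \<mu>]])
  have Ev: "?E (\<lambda>f. lnpi (f v)) = c" if "v \<in> verts H" for v
    using integral_map_pmf[of "\<lambda>f. f v" \<mu> lnpi] vertex_marginal[OF D H r that] by (simp add: c_def)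
  have Ee: "?E (\<lambda>f. - ln (card arcs) - (\<Sum>v\<in>e. lnpi (f v))) = - ln (card arcs) - 2 * c"
    if e: "e \<in> edges H" for e
  proof -
    have e': "e \<subseteq> verts H" "card e = 2" using e H by (auto simp: simple_graph_def)
    have "?E (\<lambda>f. - ln (card arcs) - (\<Sum>v\<in>e. lnpi (f v))) = - ln (card arcs) - (\<Sum>v\<in>e. ?E (\<lambda>f. lnpi (f v)))"
      by (subst Bochner_Integration.integral_diff) (simp_all add: int Bochner_Integration.integral_sum)
    also have "(\<Sum>v\<in>e. ?E (\<lambda>f. lnpi (f v))) = (\<Sum>v\<in>e. c)"
      by (rule sum.cong) (use Ev e' in auto)
    finally show ?thesis using e' by simp
  qed
  have "?E (ln_wt H) = (\<Sum>v\<in>verts H. ?E (\<lambda>f. lnpi (f v))) +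
      (\<Sum>e\<in>edges H. ?E (\<lambda>f. - ln (card arcs) - (\<Sum>v\<in>e. lnpi (f v))))"
    unfolding ln_wt_def[abs_def]
    by (subst Bochner_Integration.integral_add) (simp_all only: int Bochner_Integration.integral_sum)
  also have "\<dots> = card (verts H) * c + card (edges H) * (- ln (card arcs) - 2 * c)"
    by (simp add: Ev Ee)
  finally have Ewt: "?E (ln_wt H) = card (verts H) * c + card (edges H) * (- ln (card arcs) - 2 * c)" .
  have valG: "f v \<in> verts G" if "f \<in> set_pmf \<mu>" "v \<in> verts H" for f v
    using \<mu> that by (auto simp: Hom_def)
  have "?E (\<lambda>f. ln (\<Prod>v\<in>?I. pmf stat (f v))) = ?E (\<lambda>f. \<Sum>v\<in>?I. lnpi (f v))"
  proof (rule expectation_cong)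
    fix f assume f: "f \<in> set_pmf \<mu>"
    have "pmf stat (f v) \<noteq> 0" if "v \<in> verts H" for v
      using pmf_stat_pos[OF valG[OF f that]] by simp
    then show "ln (\<Prod>v\<in>?I. pmf stat (f v)) = (\<Sum>v\<in>?I. lnpi (f v))"
      unfolding lnpi_def using finV by (intro ln_prod) auto
  qed
  also have "\<dots> = card ?I * c" by (simp add: int Bochner_Integration.integral_sum Ev)
  finally have EI: "?E (\<lambda>f. ln (\<Prod>v\<in>?I. pmf stat (f v))) = card ?I * c" .
  have "(\<Sum>f\<in>Hom H G. \<Prod>v\<in>?I. pmf stat (f v)) =
      real (card (Hom (induced H A) G)) * (\<Sum>x\<in>verts G. pmf stat x) ^ card ?I"
    by (rule Hom_split_isolated[OF H simple AV]) (auto simp: A_def)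
  also have "(\<Sum>x\<in>verts G. pmf stat x) = 1"
    by (rule sum_pmf_eq_1) (use simple set_stat in \<open>auto simp: simple_graph_def\<close>)
  finally have sumw: "(\<Sum>f\<in>Hom H G. \<Prod>v\<in>?I. pmf stat (f v)) = real (card (Hom (induced H A) G))"
    by simp
  have "?E (\<lambda>f. ln (\<Prod>v\<in>?I. pmf stat (f v))) - ?E (\<lambda>f. ln (pmf \<mu> f)) \<le>
      ln (\<Sum>f\<in>Hom H G. \<Prod>v\<in>?I. pmf stat (f v))"
    by (rule gibbs_inequality[OF finite_Hom[OF H simple] \<mu>])
      (auto intro!: prod_nonneg prod_pos pmf_stat_pos valG)
  then have "card ?I * c - ?E (ln_wt H) \<le> ln (card (Hom (induced H A) G))"
    using entropy_bound[OF D H r] unfolding EI sumw by linarith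
  moreover have "real (card ?I) = card (verts H) - real (card A)"
    using AV finV by (simp add: card_Diff_subset finite_subset of_nat_diff card_mono)
  ultimately have "card (edges H) * ln (card arcs) + (2 * card (edges H) - real (card A)) * c
      \<le> ln (card (Hom (induced H A) G))"
    unfolding Ewt by (simp add: algebra_simps)
  \<comment> \<open>This makes the multiplication below monotone and the subtraction of naturals in
    the exponent exact.\<close>
  moreover have cA: "card A \<le> 2 * card (edges H)" unfolding A_def by (rule card_covered_vertices[OF H])
  then have "(2 * card (edges H) - real (card A)) * c \<ge> (2 * card (edges H) - real (card A)) * (- ln (card (verts G)))"
    using expectation_lnpi by (intro mult_left_mono) (auto simp: c_def)
  ultimately have *: "card (edges H) * ln (card arcs)
      \<le> ln (card (Hom (induced H A) G)) + (2 * card (edges H) - card A) * ln (card (verts G))"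
    using cA by (simp add: of_nat_diff algebra_simps)
  have n: "real (card (verts G)) > 0" using simple nonempty by (auto simp: simple_graph_def card_gt_0_iff)
  \<comment> \<open>Logarithms need a positive count; the support of \<open>\<mu>\<close> provides a
    homomorphism.\<close>
  have "Hom (induced H A) G \<noteq> {}" using Hom_restrict[OF _ AV, of _ G] \<mu> set_pmf_not_empty[of \<mu>] by blast
  then have h: "real (card (Hom (induced H A) G)) > 0"
    using finite_Hom[OF simple_graph_induced[OF H AV] simple] by (simp add: card_gt_0_iff)
  have "ln (real (card arcs) ^ card (edges H)) \<le>
      ln (real (card (Hom (induced H A) G)) * real (card (verts G)) ^ (2 * card (edges H) - card A))"
    using * n h card_arcs_pos by (simp add: ln_mult ln_realpow)
  then have "real (card arcs) ^ card (edges H) \<le>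
      real (card (Hom (induced H A) G)) * real (card (verts G)) ^ (2 * card (edges H) - card A)"
    by (subst (asm) ln_le_cancel_iff) (use n h card_arcs_pos in auto)
  then show ?thesis by (simp add: card_arcs)
qed

end

section \<open>Reduction to targets without isolated vertices\<close>

theorem theorem5:
  fixes k :: nat and H :: "'a ugraph" and G :: "'b ugraph"
  assumes "simple_graph H" and "strongly_tree_decomposable k H"
    and "simple_graph G" and "verts G \<noteq> {}"
  shows "real (card (Hom H G)) \<ge>
    real (card (verts G)) ^ card (verts H) *
      (2 * real (card (edges G)) / (real (card (verts G)))\<^sup>2) ^ card (edges H)"
proof -
  note H = assms(1) and G = assms(3)
  obtain D where D: "strong_tree_decomposition k H D"
    using assms(2) by (auto simp: strongly_tree_decomposable_def)
  define A where "A = \<Union>(edges H)"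
  let ?n = "real (card (verts G))" and ?E = "card (edges H)" and ?hA = "real (card (Hom (induced H A) G))"
  have n: "?n > 0" using G assms(4) by (auto simp: simple_graph_def card_gt_0_iff)
  have AV: "A \<subseteq> verts H" using H by (auto simp: A_def simple_graph_def)
  have finV: "finite (verts H)" using H by (simp add: simple_graph_def)
  have cA: "card A \<le> 2 * ?E" unfolding A_def by (rule card_covered_vertices[OF H])
  have cV: "card (verts H - A) + card A = card (verts H)"
    using AV finV by (metis card_Diff_subset card_mono finite_subset le_add_diff_inverse2)
  have bound: "(2 * real (card (edges G))) ^ ?E \<le> ?hA * ?n ^ (2 * ?E - card A)"
  proof (cases "edges G = {}")
    \<comment> \<open>Without edges in \<open>G\<close> the left side is 0, unless \<open>H\<close>
      has no edges either, when both sides are 1.\<close>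
    case True
    show ?thesis
    proof (cases "edges H = {}")
      case True
      then have "A = {}" by (simp add: A_def)
      then have "Hom (induced H A) G = {\<lambda>_. undefined}" by (auto simp: Hom_def)
      then show ?thesis using True \<open>A = {}\<close> by simp
    next
      case False
      then have "?E \<noteq> 0" using finite_edges[OF H] by simp
      then show ?thesis using \<open>edges G = {}\<close> by (simp add: power_0_left)
    qed
  next
    case False
    \<comment> \<open>Deleting the isolated vertices of \<open>G\<close> keeps all edges and can
      only decrease the homomorphism count and |V(G)|, hence the right side of
      \<open>bound\<close>.\<close>
    let ?W = "\<Union>(edges G)"
    let ?G = "induced G ?W"
    have W: "?W \<subseteq> verts G" using G by (auto simp: simple_graph_def)
    have edges: "edges ?G = edges G" by auto
    interpret target_graph ?G
    proof
      show "simple_graph ?G" by (rule simple_graph_induced[OF G W])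
      show "verts ?G \<noteq> {}" using False G by (force simp: simple_graph_def)
      fix x assume "x \<in> verts ?G"
      then obtain e where e: "e \<in> edges G" "x \<in> e" by auto
      obtain u v where uv: "e = {u, v}" by (rule edge_pairE[OF G e(1)])
      have "x = u \<or> x = v" using e(2) unfolding uv by blast
      moreover have "{u, v} \<in> edges G" "{v, u} \<in> edges G" using e(1) unfolding uv by (simp_all add: insert_commute)
      ultimately show "\<exists>y. {x, y} \<in> edges ?G" unfolding edges by metis
    qed
    have "A \<rightarrow>\<^sub>E ?W \<subseteq> A \<rightarrow>\<^sub>E verts G" by (rule PiE_mono) (rule W)
    then have "Hom (induced H A) ?G \<subseteq> Hom (induced H A) G"
      unfolding Hom_def edges verts_induced by blast
    then have "card (Hom (induced H A) ?G) \<le> card (Hom (induced H A) G)"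
      by (rule card_mono[OF finite_Hom[OF simple_graph_induced[OF H AV] G]])
    moreover have "card ?W \<le> card (verts G)"
      using W G by (auto simp: simple_graph_def intro: card_mono)
    ultimately have "real (card (Hom (induced H A) ?G)) * real (card ?W) ^ (2 * ?E - card A) \<le> ?hA * ?n ^ (2 * ?E - card A)"
      by (intro mult_mono power_mono) auto
    then show ?thesis using Hom_lower_bound[OF D H] unfolding edges A_def[symmetric] by simp
  qed
  \<comment> \<open>An isolated vertex of \<open>H\<close> may go anywhere in \<open>G\<close>,
    isolated vertices of \<open>G\<close> included.\<close>
  have hom: "real (card (Hom H G)) = ?hA * ?n ^ card (verts H - A)"
    using Hom_split_isolated[OF H G AV, of "\<lambda>_. 1"] by (auto simp: A_def)
  have "?n ^ card (verts H) * (2 * real (card (edges G))) ^ ?E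
      \<le> ?n ^ card (verts H) * (?hA * ?n ^ (2 * ?E - card A))"
    by (rule mult_left_mono[OF bound]) simp
  also have "\<dots> = ?hA * ?n ^ (card (verts H) + (2 * ?E - card A))" by (simp add: power_add)
  \<comment> \<open>The excess of |V(H)| over |A| is the number of isolated vertices; the other
    2|E(H)| powers of |V(G)| form the denominator of the edge density.\<close>
  also have "card (verts H) + (2 * ?E - card A) = card (verts H - A) + 2 * ?E"
    using cA cV by simp
  also have "?hA * ?n ^ (card (verts H - A) + 2 * ?E) = real (card (Hom H G)) * (?n\<^sup>2) ^ ?E"
    by (simp add: hom power_add power_mult)
  finally show ?thesis using n by (simp add: power_divide field_simps)
qed

end
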